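(* Let $\mathcal{R}=(\mathcal{F},\Pi,\mu,E,H,R)$ be an EGTRS. (1) If $\mathcal{R}$ is $E$-terminating and every conditional pair in $\mathsf{LCCP}(\mathcal{R})\cup\mathsf{CVP}^{\to_{ps}}(\mathcal{R})\cup\mathsf{DCP}(\mathcal{R})\cup\mathsf{LCCP}(E,\mathcal{R})\cup\mathsf{CVP}^{\to_{ps}}(E)$ is joinable modulo $E$ with $\to_{\mathcal{R},E}$, then $\mathcal{R}$ is $E$-confluent. (2) If there is a pair in $\mathsf{LCCP}(\mathcal{R})\cup\mathsf{CVP}^{\to_{ps}}(\mathcal{R})\cup\mathsf{DCP}(\mathcal{R})$ which is not joinable modulo $E$ with $\to_{\mathcal{R}/E}$, then $\mathcal{R}$ is not $E$-confluent.
   Context: An EGTRS $\mathcal{R}=(\mathcal{F},\Pi,\mu,E,H,R)$ consists of a signature $\mathcal{F}$ of function symbols, a signature $\Pi$ of predicate symbols containing $=,\to,\to^*$, a replacement map $\mu$ (selecting the active, i.e. rewritable, argument positions of each function symbol), a set $E$ of conditional equations $s=t\Leftarrow c$, a set $H$ of definite Horn clauses $A\Leftarrow c$ whose head predicate is not $=,\to,\to^*$, and a set $R$ of conditional rules $\ell\to r\Leftarrow c$ with $\ell$ not a variable ($c$ always a sequence of atoms); the equality predicate is assumed not to depend on $R$. $R^{rm}$ is $R$ with conditions of the form $s\approx t$ reinterpreted via rewriting modulo $E$. The relations are: $s=_E t$ ($E$-equality); $s\to_{\mathcal{R}} t$ (written for $\to_{\mathcal{R}^{rm}}$) iff there are an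 active position $p$ of $s$, a rule $\ell\to r\Leftarrow c$ in $R^{rm}$ and a substitution $\sigma$ with $s|_p=\sigma(\ell)$, all atoms of $\sigma(c)$ deducible (conditions being evaluated using rewriting modulo), and $t=s[\sigma(r)]_p$; $s\to_{\mathcal{R},E}t$ (Peterson–Stickel rewriting, also denoted $\to_{ps}$) is defined the same way but with $s|_p=_E\sigma(\ell)$; $\to_{\mathcal{R}/E}={=_E}\circ\to_{\mathcal{R}}\circ{=_E}$. $\mathcal{R}$ is $E$-terminating iff $\to_{\mathcal{R}/E}$ is terminating; $\mathcal{R}$ is $E$-confluent iff whenever $t\to^*_{\mathcal{R}/E}t_1$ and $t\to^*_{\mathcal{R}/E}t_2$ there are $t_1',t_2'$ with $t_1\to^*_{\mathcal{R}/E}t_1'$, $t_2\to^*_{\mathcal{R}/E}t_2'$ and $t_1'=_E t_2'$. $\overleftrightarrow{E}$ denotes the (possibly variable-left-hand-side) rules $\lambda\to\rho\Leftarrow\gamma$ obtained by orienting each equation of $E$ both ways. A conditional pair $\langle s,t\rangle\Leftarrow c$ is feasible if some substitution satisfies all atoms of $c$; it is joinable modulo $E$ with a relation $\to$ if for every substitution $\sigma$ satisfying $c$ there are $u,u'$ with $\sigma(s)\to^*u$, $\sigma(t)\to^*u'$ and $u=_E u'$. $\mathsf{LCCP}(\mathcal{R})$: feasible pairs $\langle \ell[r']_p,r\rangle\Leftarrow \ell|_p=\ell',c,c'$ for variable-disjoint rules $\ell\to r\Leftarrow c$, $\ell'\to r'\Leftarrow c'$ in $R^{rm}$ and an active non-variable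 position $p$ of $\ell$. $\mathsf{LCCP}(E,\mathcal{R})$: feasible pairs $\langle \lambda[r]_p,\rho\rangle\Leftarrow \lambda|_p=\ell,\gamma,c$ for $\lambda\to\rho\Leftarrow\gamma$ in $\overleftrightarrow{E}$, $\ell\to r\Leftarrow c$ in $R^{rm}$ (variable-disjoint) and an active non-variable position $p$ of $\lambda$. $\mathsf{CVP}^{\to_{ps}}(\mathcal{R})$ (resp. $\mathsf{CVP}^{\to_{ps}}(E)$): feasible pairs $\langle \ell[x']_p,r\rangle\Leftarrow x\to_{ps}x',c$ for a rule $\ell\to r\Leftarrow c$ in $R^{rm}$ (resp. in $\overleftrightarrow{E}$), an active variable $x$ of $\ell$, an active position $p$ of $x$ in $\ell$ and a fresh variable $x'$. $\mathsf{DCP}(\mathcal{R})$: feasible pairs $\langle r,x'\rangle\Leftarrow x=\ell, x\to_{inner}x',c$ for a rule $\ell\to r\Leftarrow c$ in $R^{rm}$, with $x,x'$ fresh variables and $\to_{inner}$ a non-root $\to_{\mathcal{R}}$-step. *)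

theory Defs
  imports "HOL-Library.Countable" "HOL-Library.Infinite_Typeclass"
begin

datatype (fsyms: 'f, vars: 'v) trm = Var 'v | Fun 'f "('f, 'v) trm list"

type_synonym ('f, 'v) subst = "'v \<Rightarrow> ('f, 'v) trm"

fun subst :: "('f, 'v) subst \<Rightarrow> ('f, 'v) trm \<Rightarrow> ('f, 'v) trm" where
  "subst \<sigma> (Var x) = \<sigma> x"
| "subst \<sigma> (Fun f ts) = Fun f (map (subst \<sigma>) ts)"

lemma size_nth_trm [termination_simp]:
  "i < length ts \<Longrightarrow> size (ts ! i) < Suc (size_list size ts)"
  by (metis le_imp_less_Suc nth_mem order_refl size_list_estimation')

declare conj_cong [fundef_cong]

text \<open>Positions are lists of argument indices; indices start at 0.\<close>

fun active_poss :: "('f \<Rightarrow> nat set) \<Rightarrow> ('f, 'v) trm \<Rightarrow> nat list set" where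
  "active_poss \<mu> (Var x) = {[]}"
| "active_poss \<mu> (Fun f ts) =
     {[]} \<union> {i # p | i p. i < length ts \<and> i \<in> \<mu> f \<and> p \<in> active_poss \<mu> (ts ! i)}"

declare conj_cong [fundef_cong del]

fun subt_at :: "('f, 'v) trm \<Rightarrow> nat list \<Rightarrow> ('f, 'v) trm" where
  "subt_at t [] = t"
| "subt_at (Fun f ts) (i # p) = subt_at (ts ! i) p"
| "subt_at (Var x) (i # p) = Var x"

fun replace_at :: "('f, 'v) trm \<Rightarrow> nat list \<Rightarrow> ('f, 'v) trm \<Rightarrow> ('f, 'v) trm" where
  "replace_at t [] u = u"
| "replace_at (Fun f ts) (i # p) u = Fun f (ts[i := replace_at (ts ! i) p u])"
| "replace_at (Var x) (i # p) u = Var x"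

text \<open>
  The constructors \<open>Eq\<close>, \<open>Step\<close>, \<open>Steps\<close> are the predicates \<open>=\<close>, \<open>\<rightarrow>\<close>, \<open>\<rightarrow>\<^sup>*\<close>, present in every
  predicate signature; \<open>Approx s t\<close> is a condition \<open>s \<approx> t\<close>, which has no meaning until it is
  interpreted (see \<open>rm\<close> below).
\<close>

datatype (atom_fsyms: 'f, atom_psyms: 'p, atom_vars: 'v) atom =
    Eq "('f, 'v) trm" "('f, 'v) trm"
  | Step "('f, 'v) trm" "('f, 'v) trm"
  | Steps "('f, 'v) trm" "('f, 'v) trm"
  | Approx "('f, 'v) trm" "('f, 'v) trm"
  | Pred 'p "('f, 'v) trm list"

fun subst_atom :: "('f, 'v) subst \<Rightarrow> ('f, 'p, 'v) atom \<Rightarrow> ('f, 'p, 'v) atom" where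
  "subst_atom \<sigma> (Eq s t) = Eq (subst \<sigma> s) (subst \<sigma> t)"
| "subst_atom \<sigma> (Step s t) = Step (subst \<sigma> s) (subst \<sigma> t)"
| "subst_atom \<sigma> (Steps s t) = Steps (subst \<sigma> s) (subst \<sigma> t)"
| "subst_atom \<sigma> (Approx s t) = Approx (subst \<sigma> s) (subst \<sigma> t)"
| "subst_atom \<sigma> (Pred P ts) = Pred P (map (subst \<sigma>) ts)"

datatype 'p psym = PEq | PStep | PSteps | PApprox | PUser 'p

fun psym_of :: "('f, 'p, 'v) atom \<Rightarrow> 'p psym" where
  "psym_of (Eq s t) = PEq"
| "psym_of (Step s t) = PStep"
| "psym_of (Steps s t) = PSteps"
| "psym_of (Approx s t) = PApprox"
| "psym_of (Pred P ts) = PUser P"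

text \<open>A triple \<open>(l, r, c)\<close> is a conditional rule or equation with condition \<open>c\<close>.\<close>

type_synonym ('f, 'p, 'v) crule =
  "('f, 'v) trm \<times> ('f, 'v) trm \<times> ('f, 'p, 'v) atom list"

record ('f, 'p, 'v) egtrs =
  funs :: "'f set"
  arity :: "'f \<Rightarrow> nat"
  preds :: "'p set"
  parity :: "'p \<Rightarrow> nat"
  repl :: "'f \<Rightarrow> nat set"
  eqs :: "('f, 'p, 'v) crule set"
  horn :: "(('f, 'p, 'v) atom \<times> ('f, 'p, 'v) atom list) set"
  rules :: "('f, 'p, 'v) crule set"

fun wf_trm :: "('f, 'p, 'v) egtrs \<Rightarrow> ('f, 'v) trm \<Rightarrow> bool" where
  "wf_trm \<R> (Var x) \<longleftrightarrow> True"
| "wf_trm \<R> (Fun f ts) \<longleftrightarrow>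
     f \<in> funs \<R> \<and> length ts = arity \<R> f \<and> (\<forall>t \<in> set ts. wf_trm \<R> t)"

fun wf_atom :: "('f, 'p, 'v) egtrs \<Rightarrow> ('f, 'p, 'v) atom \<Rightarrow> bool" where
  "wf_atom \<R> (Eq s t) \<longleftrightarrow> wf_trm \<R> s \<and> wf_trm \<R> t"
| "wf_atom \<R> (Step s t) \<longleftrightarrow> wf_trm \<R> s \<and> wf_trm \<R> t"
| "wf_atom \<R> (Steps s t) \<longleftrightarrow> wf_trm \<R> s \<and> wf_trm \<R> t"
| "wf_atom \<R> (Approx s t) \<longleftrightarrow> wf_trm \<R> s \<and> wf_trm \<R> t"
| "wf_atom \<R> (Pred P ts) \<longleftrightarrow>
     P \<in> preds \<R> \<and> length ts = parity \<R> P \<and> (\<forall>t \<in> set ts. wf_trm \<R> t)"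

definition wf_subst :: "('f, 'p, 'v) egtrs \<Rightarrow> ('f, 'v) subst \<Rightarrow> bool" where
  "wf_subst \<R> \<sigma> \<longleftrightarrow> (\<forall>x. wf_trm \<R> (\<sigma> x))"

definition clauses ::
  "('f, 'p, 'v) egtrs \<Rightarrow> (('f, 'p, 'v) atom \<times> ('f, 'p, 'v) atom list) set" where
  "clauses \<R> = {(Eq s t, c) | s t c. (s, t, c) \<in> eqs \<R>} \<union> horn \<R> \<union>
     {(Step l r, c) | l r c. (l, r, c) \<in> rules \<R>}"

definition psym_dep :: "('f, 'p, 'v) egtrs \<Rightarrow> ('p psym \<times> 'p psym) set" where
  "psym_dep \<R> = {(psym_of A, psym_of B) | A B c. (A, c) \<in> clauses \<R> \<and> B \<in> set c}"

definition is_egtrs :: "('f, 'p, 'v) egtrs \<Rightarrow> bool" where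
  "is_egtrs \<R> \<longleftrightarrow>
     (\<forall>f \<in> funs \<R>. repl \<R> f \<subseteq> {..<arity \<R> f}) \<and>
     (\<forall>(A, c) \<in> clauses \<R>. wf_atom \<R> A \<and> (\<forall>B \<in> set c. wf_atom \<R> B)) \<and>
     (\<forall>(A, c) \<in> horn \<R>. \<exists>P. psym_of A = PUser P) \<and>
     (\<forall>(l, r, c) \<in> rules \<R>. \<nexists>x. l = Var x) \<and>
     (\<forall>Q \<in> {PStep, PSteps, PApprox}. (PEq, Q) \<notin> (psym_dep \<R>)\<^sup>+)"

text \<open>
  In \<open>rm \<R>\<close> a condition \<open>s \<approx> t\<close> becomes \<open>s \<rightarrow>\<^sup>* t\<close>, and \<open>ded\<close> below evaluates \<open>\<rightarrow>\<close> and \<open>\<rightarrow>\<^sup>*\<close>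
  by rewriting modulo. Conditions \<open>s \<approx> t\<close> in equations are excluded by \<open>is_egtrs\<close>.
\<close>

fun rm_atom :: "('f, 'p, 'v) atom \<Rightarrow> ('f, 'p, 'v) atom" where
  "rm_atom (Approx s t) = Steps s t"
| "rm_atom A = A"

definition rm :: "('f, 'p, 'v) egtrs \<Rightarrow> ('f, 'p, 'v) egtrs" where
  "rm \<R> = \<R>\<lparr>horn := {(A, map rm_atom c) | A c. (A, c) \<in> horn \<R>},
            rules := {(l, r, map rm_atom c) | l r c. (l, r, c) \<in> rules \<R>}\<rparr>"

text \<open>
  Deducibility of atoms. Equality is a congruence in all arguments, active or not. A deducible
  \<open>Step s t\<close> is a step of rewriting modulo, so that this is what rule conditions refer to.
\<close>

inductive ded :: "('f, 'p, 'v) egtrs \<Rightarrow> ('f, 'p, 'v) atom \<Rightarrow> bool" for \<R> where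
  eq_refl: "wf_trm \<R> t \<Longrightarrow> ded \<R> (Eq t t)"
| eq_sym: "ded \<R> (Eq s t) \<Longrightarrow> ded \<R> (Eq t s)"
| eq_trans: "ded \<R> (Eq s t) \<Longrightarrow> ded \<R> (Eq t u) \<Longrightarrow> ded \<R> (Eq s u)"
| eq_cong: "wf_trm \<R> (Fun f ts) \<Longrightarrow> i < length ts \<Longrightarrow> ded \<R> (Eq (ts ! i) u) \<Longrightarrow>
    ded \<R> (Eq (Fun f ts) (Fun f (ts[i := u])))"
| eq_clause: "(s, t, c) \<in> eqs \<R> \<Longrightarrow> wf_subst \<R> \<sigma> \<Longrightarrow>
    (\<And>A. A \<in> set c \<Longrightarrow> ded \<R> (subst_atom \<sigma> A)) \<Longrightarrow> ded \<R> (Eq (subst \<sigma> s) (subst \<sigma> t))"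
| horn_clause: "(B, c) \<in> horn \<R> \<Longrightarrow> wf_subst \<R> \<sigma> \<Longrightarrow>
    (\<And>A. A \<in> set c \<Longrightarrow> ded \<R> (subst_atom \<sigma> A)) \<Longrightarrow> ded \<R> (subst_atom \<sigma> B)"
| step: "ded \<R> (Eq s u) \<Longrightarrow> p \<in> active_poss (repl \<R>) u \<Longrightarrow>
    (l, r, c) \<in> rules \<R> \<Longrightarrow> wf_subst \<R> \<sigma> \<Longrightarrow> subt_at u p = subst \<sigma> l \<Longrightarrow>
    (\<And>A. A \<in> set c \<Longrightarrow> ded \<R> (subst_atom \<sigma> A)) \<Longrightarrow>
    ded \<R> (Eq (replace_at u p (subst \<sigma> r)) t) \<Longrightarrow> ded \<R> (Step s t)"
| steps_refl: "wf_trm \<R> t \<Longrightarrow> ded \<R> (Steps t t)"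
| steps_step: "ded \<R> (Step s t) \<Longrightarrow> ded \<R> (Steps t u) \<Longrightarrow> ded \<R> (Steps s u)"

definition E_eq :: "('f, 'p, 'v) egtrs \<Rightarrow> ('f, 'v) trm \<Rightarrow> ('f, 'v) trm \<Rightarrow> bool" where
  "E_eq \<R> s t \<longleftrightarrow> ded (rm \<R>) (Eq s t)"

definition rew_at ::
  "('f, 'p, 'v) egtrs \<Rightarrow> nat list \<Rightarrow> ('f, 'v) trm \<Rightarrow> ('f, 'v) trm \<Rightarrow> bool" where
  "rew_at \<R> p s t \<longleftrightarrow> wf_trm \<R> s \<and> p \<in> active_poss (repl \<R>) s \<and>
     (\<exists>l r c \<sigma>. (l, r, c) \<in> rules (rm \<R>) \<and> wf_subst \<R> \<sigma> \<and> subt_at s p = subst \<sigma> l \<and>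
        (\<forall>A \<in> set c. ded (rm \<R>) (subst_atom \<sigma> A)) \<and> t = replace_at s p (subst \<sigma> r))"

definition rew :: "('f, 'p, 'v) egtrs \<Rightarrow> ('f, 'v) trm \<Rightarrow> ('f, 'v) trm \<Rightarrow> bool" where
  "rew \<R> s t \<longleftrightarrow> (\<exists>p. rew_at \<R> p s t)"

definition inner_rew :: "('f, 'p, 'v) egtrs \<Rightarrow> ('f, 'v) trm \<Rightarrow> ('f, 'v) trm \<Rightarrow> bool" where
  "inner_rew \<R> s t \<longleftrightarrow> (\<exists>p. p \<noteq> [] \<and> rew_at \<R> p s t)"

definition ps_rew :: "('f, 'p, 'v) egtrs \<Rightarrow> ('f, 'v) trm \<Rightarrow> ('f, 'v) trm \<Rightarrow> bool" where
  "ps_rew \<R> s t \<longleftrightarrow> wf_trm \<R> s \<and> (\<exists>p \<in> active_poss (repl \<R>) s.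
     \<exists>l r c \<sigma>. (l, r, c) \<in> rules (rm \<R>) \<and> wf_subst \<R> \<sigma> \<and> E_eq \<R> (subt_at s p) (subst \<sigma> l) \<and>
        (\<forall>A \<in> set c. ded (rm \<R>) (subst_atom \<sigma> A)) \<and> t = replace_at s p (subst \<sigma> r))"

definition mod_rew :: "('f, 'p, 'v) egtrs \<Rightarrow> ('f, 'v) trm \<Rightarrow> ('f, 'v) trm \<Rightarrow> bool" where
  "mod_rew \<R> = E_eq \<R> OO rew \<R> OO E_eq \<R>"

definition E_terminating :: "('f, 'p, 'v) egtrs \<Rightarrow> bool" where
  "E_terminating \<R> \<longleftrightarrow> (\<nexists>s. \<forall>i::nat. mod_rew \<R> (s i) (s (Suc i)))"

definition E_confluent :: "('f, 'p, 'v) egtrs \<Rightarrow> bool" where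
  "E_confluent \<R> \<longleftrightarrow> (\<forall>t t1 t2. wf_trm \<R> t \<and> (mod_rew \<R>)\<^sup>*\<^sup>* t t1 \<and> (mod_rew \<R>)\<^sup>*\<^sup>* t t2 \<longrightarrow>
     (\<exists>t1' t2'. (mod_rew \<R>)\<^sup>*\<^sup>* t1 t1' \<and> (mod_rew \<R>)\<^sup>*\<^sup>* t2 t2' \<and> E_eq \<R> t1' t2'))"

text \<open>
  Conditions of conditional pairs may also contain the predicates \<open>\<rightarrow>\<^sub>p\<^sub>s\<close> and \<open>\<rightarrow>\<^sub>i\<^sub>n\<^sub>n\<^sub>e\<^sub>r\<close>, which are
  not available in the clauses of an EGTRS.
\<close>

datatype ('f, 'p, 'v) patom =
    Base "('f, 'p, 'v) atom"
  | PSStep "('f, 'v) trm" "('f, 'v) trm"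
  | InnerStep "('f, 'v) trm" "('f, 'v) trm"

type_synonym ('f, 'p, 'v) cpair =
  "('f, 'v) trm \<times> ('f, 'v) trm \<times> ('f, 'p, 'v) patom list"

fun sat_patom :: "('f, 'p, 'v) egtrs \<Rightarrow> ('f, 'v) subst \<Rightarrow> ('f, 'p, 'v) patom \<Rightarrow> bool" where
  "sat_patom \<R> \<sigma> (Base A) \<longleftrightarrow> ded (rm \<R>) (subst_atom \<sigma> A)"
| "sat_patom \<R> \<sigma> (PSStep s t) \<longleftrightarrow> ps_rew \<R> (subst \<sigma> s) (subst \<sigma> t)"
| "sat_patom \<R> \<sigma> (InnerStep s t) \<longleftrightarrow> inner_rew \<R> (subst \<sigma> s) (subst \<sigma> t)"

definition satisfies ::
  "('f, 'p, 'v) egtrs \<Rightarrow> ('f, 'v) subst \<Rightarrow> ('f, 'p, 'v) patom list \<Rightarrow> bool" where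
  "satisfies \<R> \<sigma> c \<longleftrightarrow> wf_subst \<R> \<sigma> \<and> (\<forall>A \<in> set c. sat_patom \<R> \<sigma> A)"

definition feasible :: "('f, 'p, 'v) egtrs \<Rightarrow> ('f, 'p, 'v) cpair \<Rightarrow> bool" where
  "feasible \<R> = (\<lambda>(s, t, c). \<exists>\<sigma>. satisfies \<R> \<sigma> c)"

definition joinable_mod ::
  "('f, 'p, 'v) egtrs \<Rightarrow> (('f, 'v) trm \<Rightarrow> ('f, 'v) trm \<Rightarrow> bool) \<Rightarrow> ('f, 'p, 'v) cpair \<Rightarrow> bool" where
  "joinable_mod \<R> rel = (\<lambda>(s, t, c). \<forall>\<sigma>. satisfies \<R> \<sigma> c \<longrightarrow>
     (\<exists>u u'. rel\<^sup>*\<^sup>* (subst \<sigma> s) u \<and> rel\<^sup>*\<^sup>* (subst \<sigma> t) u' \<and> E_eq \<R> u u'))"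

definition rule_vars :: "('f, 'p, 'v) crule \<Rightarrow> 'v set" where
  "rule_vars = (\<lambda>(l, r, c). vars l \<union> vars r \<union> (\<Union>A \<in> set c. atom_vars A))"

definition rename_rule :: "('v \<Rightarrow> 'v) \<Rightarrow> ('f, 'p, 'v) crule \<Rightarrow> ('f, 'p, 'v) crule" where
  "rename_rule \<pi> = (\<lambda>(l, r, c).
     (subst (Var \<circ> \<pi>) l, subst (Var \<circ> \<pi>) r, map (subst_atom (Var \<circ> \<pi>)) c))"

definition variants :: "('f, 'p, 'v) crule set \<Rightarrow> ('f, 'p, 'v) crule set" where
  "variants S = {rename_rule \<pi> \<alpha> | \<pi> \<alpha>. bij \<pi> \<and> \<alpha> \<in> S}"

definition oriented_eqs :: "('f, 'p, 'v) egtrs \<Rightarrow> ('f, 'p, 'v) crule set" where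
  "oriented_eqs \<R> = eqs \<R> \<union> {(t, s, c) | s t c. (s, t, c) \<in> eqs \<R>}"

text \<open>
  Logic-based conditional critical pairs from rules of \<open>S\<close> (outer rule) and \<open>S'\<close> (inner rule);
  the inner rule is renamed apart.
\<close>

definition LCCPs ::
  "('f, 'p, 'v) egtrs \<Rightarrow> ('f, 'p, 'v) crule set \<Rightarrow> ('f, 'p, 'v) crule set \<Rightarrow>
   ('f, 'p, 'v) cpair set" where
  "LCCPs \<R> S S' = {\<pi>. feasible \<R> \<pi> \<and> (\<exists>l r c l' r' c' p.
     (l, r, c) \<in> S \<and> (l', r', c') \<in> variants S' \<and>
     rule_vars (l, r, c) \<inter> rule_vars (l', r', c') = {} \<and>
     p \<in> active_poss (repl \<R>) l \<and> (\<nexists>x. subt_at l p = Var x) \<and>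
     \<pi> = (replace_at l p r', r, Base (Eq (subt_at l p) l') # map Base c @ map Base c'))}"

definition CVPs ::
  "('f, 'p, 'v) egtrs \<Rightarrow> ('f, 'p, 'v) crule set \<Rightarrow> ('f, 'p, 'v) cpair set" where
  "CVPs \<R> S = {\<pi>. feasible \<R> \<pi> \<and> (\<exists>l r c p x x'.
     (l, r, c) \<in> S \<and> p \<in> active_poss (repl \<R>) l \<and> subt_at l p = Var x \<and>
     x' \<notin> rule_vars (l, r, c) \<and>
     \<pi> = (replace_at l p (Var x'), r, PSStep (Var x) (Var x') # map Base c))}"

definition LCCP :: "('f, 'p, 'v) egtrs \<Rightarrow> ('f, 'p, 'v) cpair set" where
  "LCCP \<R> = LCCPs \<R> (rules (rm \<R>)) (rules (rm \<R>))"

definition LCCP_E :: "('f, 'p, 'v) egtrs \<Rightarrow> ('f, 'p, 'v) cpair set" where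
  "LCCP_E \<R> = LCCPs \<R> (oriented_eqs \<R>) (rules (rm \<R>))"

definition CVP_ps :: "('f, 'p, 'v) egtrs \<Rightarrow> ('f, 'p, 'v) cpair set" where
  "CVP_ps \<R> = CVPs \<R> (rules (rm \<R>))"

definition CVP_ps_E :: "('f, 'p, 'v) egtrs \<Rightarrow> ('f, 'p, 'v) cpair set" where
  "CVP_ps_E \<R> = CVPs \<R> (oriented_eqs \<R>)"

definition DCP :: "('f, 'p, 'v) egtrs \<Rightarrow> ('f, 'p, 'v) cpair set" where
  "DCP \<R> = {\<pi>. feasible \<R> \<pi> \<and> (\<exists>l r c x x'.
     (l, r, c) \<in> rules (rm \<R>) \<and> x \<noteq> x' \<and> x \<notin> rule_vars (l, r, c) \<and> x' \<notin> rule_vars (l, r, c) \<and>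
     \<pi> = (r, Var x', Base (Eq (Var x) l) # InnerStep (Var x) (Var x') # map Base c))}"

text \<open>
  Rewriting steps in conditions mean rewriting modulo, and since equality does not depend on the
  rules, \<open>E_eq\<close> is deducibility from the equations and Horn clauses alone.
\<close>

lemma sig_rm [simp]: "funs (rm \<R>) = funs \<R>" "arity (rm \<R>) = arity \<R>" "eqs (rm \<R>) = eqs \<R>"
  by (simp_all add: rm_def)

lemma wf_trm_rm [simp]: "wf_trm (rm \<R>) t = wf_trm \<R> t"
  by (induction t) auto

lemma wf_subst_rm [simp]: "wf_subst (rm \<R>) \<sigma> = wf_subst \<R> \<sigma>"
  by (simp add: wf_subst_def)

lemma repl_rm [simp]: "repl (rm \<R>) = repl \<R>"
  by (simp add: rm_def)

lemma wf_trm_subst: "wf_subst \<R> \<sigma> \<Longrightarrow> wf_trm \<R> t \<Longrightarrow> wf_trm \<R> (subst \<sigma> t)"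
  by (induction t) (auto simp: wf_subst_def)

lemma is_egtrs_eqs_wf:
  assumes "is_egtrs \<R>" "(s, t, c) \<in> eqs \<R>" shows "wf_trm \<R> s" "wf_trm \<R> t"
proof -
  have "(Eq s t, c) \<in> clauses \<R>" using assms(2) by (simp add: clauses_def)
  moreover have "\<forall>(A, c) \<in> clauses \<R>. wf_atom \<R> A \<and> (\<forall>B \<in> set c. wf_atom \<R> B)"
    using assms(1) by (simp add: is_egtrs_def)
  ultimately have "wf_atom \<R> (Eq s t)" by blast
  then show "wf_trm \<R> s" "wf_trm \<R> t" by simp_all
qed

lemma horn_rmE:
  assumes "(B, c) \<in> horn (rm \<R>)"
  obtains c0 where "(B, c0) \<in> horn \<R>" "c = map rm_atom c0"
  using assms by (auto simp: rm_def)

lemma is_egtrs_horn_head: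
  assumes "is_egtrs \<R>" "(B, c) \<in> horn (rm \<R>)" shows "\<exists>P ts. B = Pred P ts"
proof -
  obtain c0 where "(B, c0) \<in> horn \<R>" using assms(2) by (rule horn_rmE)
  moreover have "\<forall>(A, c) \<in> horn \<R>. \<exists>P. psym_of A = PUser P"
    using assms(1) by (simp add: is_egtrs_def)
  ultimately have "\<exists>P. psym_of B = PUser P" by blast
  then show ?thesis by (cases B) auto
qed

lemma ded_Eq_wf:
  assumes "is_egtrs \<R>" "ded (rm \<R>) A"
  shows "A = Eq s t \<Longrightarrow> wf_trm \<R> s \<and> wf_trm \<R> t"
  using assms(2)
proof (induction arbitrary: s t rule: ded.induct)
  case (eq_cong f ts i u)
  then have "wf_trm \<R> u" by blast
  then have "\<forall>t \<in> set (ts[i := u]). wf_trm \<R> t"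
    using eq_cong(1) set_update_subset_insert[of ts i u] by auto
  then show ?case using eq_cong(1) eq_cong.prems by auto
next
  case (eq_clause s t c \<sigma>)
  then show ?case using is_egtrs_eqs_wf[OF assms(1)] by (auto simp: wf_trm_subst)
next
  case (horn_clause B c \<sigma>)
  then obtain P ts where "B = Pred P ts"
    using is_egtrs_horn_head[OF assms(1)] by blast
  then show ?case using horn_clause.prems by simp
qed auto

lemma ded_Step_iff:
  assumes "is_egtrs \<R>"
  shows "ded (rm \<R>) (Step s t) \<longleftrightarrow> mod_rew \<R> s t"
proof
  assume "ded (rm \<R>) (Step s t)"
  then show "mod_rew \<R> s t"
  proof cases
    case (horn_clause B c \<sigma>)
    then obtain P ts where "B = Pred P ts"
      using is_egtrs_horn_head[OF assms] by blast
    then show ?thesis using horn_clause by simp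
  next
    case (step u p l r c \<sigma>)
    then have "rew \<R> u (replace_at u p (subst \<sigma> r))"
      using ded_Eq_wf[OF assms step(1) refl] unfolding rew_def rew_at_def
      by (intro exI[of _ p] conjI exI[of _ l] exI[of _ r] exI[of _ c] exI[of _ \<sigma>]) auto
    then show ?thesis using step unfolding mod_rew_def E_eq_def by blast
  qed
next
  assume "mod_rew \<R> s t"
  then show "ded (rm \<R>) (Step s t)"
    unfolding mod_rew_def E_eq_def rew_def rew_at_def by (auto intro: ded.step)
qed

lemma ded_Steps_iff:
  assumes "is_egtrs \<R>" "wf_trm \<R> s"
  shows "ded (rm \<R>) (Steps s t) \<longleftrightarrow> (mod_rew \<R>)\<^sup>*\<^sup>* s t"
proof
  have "A = Steps s t \<Longrightarrow> (mod_rew \<R>)\<^sup>*\<^sup>* s t" if "ded (rm \<R>) A" for A s t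
    using that
  proof (induction arbitrary: s t rule: ded.induct)
    case (horn_clause B c \<sigma>)
    then obtain P ts where "B = Pred P ts"
      using is_egtrs_horn_head[OF assms(1)] by blast
    then show ?case using horn_clause.prems by simp
  next
    case (steps_step s t u)
    then show ?case using ded_Step_iff[OF assms(1)]
      by (auto intro: converse_rtranclp_into_rtranclp)
  qed auto
  then show "ded (rm \<R>) (Steps s t) \<Longrightarrow> (mod_rew \<R>)\<^sup>*\<^sup>* s t" by blast
next
  assume "(mod_rew \<R>)\<^sup>*\<^sup>* s t"
  then show "ded (rm \<R>) (Steps s t)" using assms(2)
  proof (induction rule: converse_rtranclp_induct)
    case base
    then show ?case by (simp add: ded.steps_refl)
  next
    case (step s u)
    have "wf_trm \<R> u"
      using step(1) ded_Eq_wf[OF assms(1)] unfolding mod_rew_def E_eq_def by blast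
    with step show ?case using ded_Step_iff[OF assms(1)] by (auto intro: ded.steps_step)
  qed
qed

lemma psym_of_subst_atom [simp]: "psym_of (subst_atom \<sigma> A) = psym_of A"
  by (cases A) auto

lemma wf_trm_rules_update [simp]: "wf_trm (\<R>\<lparr>rules := S\<rparr>) t = wf_trm \<R> t"
  by (induction t) auto

lemma wf_subst_rules_update [simp]: "wf_subst (\<R>\<lparr>rules := S\<rparr>) \<sigma> = wf_subst \<R> \<sigma>"
  by (simp add: wf_subst_def)

lemma E_eq_iff_ded_without_rules:
  assumes "is_egtrs \<R>"
  shows "E_eq \<R> s t \<longleftrightarrow> ded (\<R>\<lparr>rules := {}\<rparr>) (Eq s t)"
proof
  let ?D = "{Q. (PEq, Q) \<in> (psym_dep \<R>)\<^sup>*}"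
  have no: "PStep \<notin> ?D" "PSteps \<notin> ?D" "PApprox \<notin> ?D"
    using assms unfolding is_egtrs_def by (auto simp: rtrancl_eq_or_trancl)
  have cl: "psym_of B \<in> ?D" if "(A, c) \<in> clauses \<R>" "psym_of A \<in> ?D" "B \<in> set c" for A B c
    using that unfolding psym_dep_def by (auto intro: rtrancl_into_rtrancl)
  have rm_id: "rm_atom B = B" if "psym_of B \<in> ?D" for B :: "('a, 'b, 'c) atom"
    using that no(3) by (cases B) auto
  have "psym_of A \<in> ?D \<Longrightarrow> ded (\<R>\<lparr>rules := {}\<rparr>) A" if "ded (rm \<R>) A" for A
    using that
  proof (induction rule: ded.induct)
    case (eq_clause s t c \<sigma>)
    have *: "(s, t, c) \<in> eqs \<R>" using eq_clause by simp
    have "(Eq s t, c) \<in> clauses \<R>" using * by (auto simp: clauses_def)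
    from cl[OF this] eq_clause * show ?case
      by (intro ded.eq_clause[of _ _ c]) simp_all
  next
    case (horn_clause B c \<sigma>)
    obtain c0 where *: "(B, c0) \<in> horn \<R>" "c = map rm_atom c0"
      using horn_clause(1) by (rule horn_rmE)
    have "(B, c0) \<in> clauses \<R>" using * by (auto simp: clauses_def)
    from cl[OF this] horn_clause.prems have D: "\<And>A. A \<in> set c0 \<Longrightarrow> psym_of A \<in> ?D" by auto
    then have [simp]: "c = c0" using rm_id *(2) by (metis map_idI)
    show ?case
    proof (rule ded.horn_clause)
      show "(B, c0) \<in> horn (\<R>\<lparr>rules := {}\<rparr>)" using * by simp
      show "wf_subst (\<R>\<lparr>rules := {}\<rparr>) \<sigma>" using horn_clause(2) by simp
      show "ded (\<R>\<lparr>rules := {}\<rparr>) (subst_atom \<sigma> A)" if "A \<in> set c0" for A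
        using horn_clause.IH[of A] D[OF that] that by simp
    qed
  next
    case (eq_sym s t)
    then show ?case by (auto intro: ded.eq_sym)
  next
    case (eq_trans s t u)
    then show ?case by (auto intro: ded.eq_trans)
  next
    case (eq_cong f ts i u)
    then show ?case by (intro ded.eq_cong) auto
  qed (use no in \<open>auto intro: ded.eq_refl\<close>)
  then show "E_eq \<R> s t \<Longrightarrow> ded (\<R>\<lparr>rules := {}\<rparr>) (Eq s t)" by (simp add: E_eq_def)
next
  let ?D = "{Q. (PEq, Q) \<in> (psym_dep \<R>)\<^sup>*}"
  have no: "PStep \<notin> ?D" "PSteps \<notin> ?D" "PApprox \<notin> ?D"
    using assms unfolding is_egtrs_def by (auto simp: rtrancl_eq_or_trancl)
  have cl: "psym_of B \<in> ?D" if "(A, c) \<in> clauses \<R>" "psym_of A \<in> ?D" "B \<in> set c" for A B c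
    using that unfolding psym_dep_def by (auto intro: rtrancl_into_rtrancl)
  have rm_id: "rm_atom B = B" if "psym_of B \<in> ?D" for B :: "('a, 'b, 'c) atom"
    using that no(3) by (cases B) auto
  have "psym_of A \<in> ?D \<Longrightarrow> ded (rm \<R>) A" if "ded (\<R>\<lparr>rules := {}\<rparr>) A" for A
    using that
  proof (induction rule: ded.induct)
    case (eq_clause s t c \<sigma>)
    have *: "(s, t, c) \<in> eqs \<R>" using eq_clause by simp
    have "(Eq s t, c) \<in> clauses \<R>" using * by (auto simp: clauses_def)
    from cl[OF this] eq_clause * show ?case
      by (intro ded.eq_clause[of _ _ c]) simp_all
  next
    case (horn_clause B c \<sigma>)
    then have *: "(B, c) \<in> clauses \<R>" by (auto simp: clauses_def)
    from cl[OF this] horn_clause.prems have D: "\<And>A. A \<in> set c \<Longrightarrow> psym_of A \<in> ?D" by auto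
    then have id: "map rm_atom c = c" using rm_id by (metis map_idI)
    show ?case
    proof (rule ded.horn_clause)
      have "(B, map rm_atom c) \<in> horn (rm \<R>)" using horn_clause(1) by (auto simp: rm_def)
      then show "(B, c) \<in> horn (rm \<R>)" by (simp only: id)
      show "wf_subst (rm \<R>) \<sigma>" using horn_clause(2) by simp
      show "ded (rm \<R>) (subst_atom \<sigma> A)" if "A \<in> set c" for A
        using horn_clause.IH[of A] D[OF that] that by simp
    qed
  next
    case (eq_sym s t)
    then show ?case by (auto intro: ded.eq_sym)
  next
    case (eq_trans s t u)
    then show ?case by (auto intro: ded.eq_trans)
  next
    case (eq_cong f ts i u)
    then show ?case by (intro ded.eq_cong) auto
  qed (use no in \<open>auto intro: ded.eq_refl\<close>)
  then show "ded (\<R>\<lparr>rules := {}\<rparr>) (Eq s t) \<Longrightarrow> E_eq \<R> s t" by (simp add: E_eq_def)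
qed

end

theory Submission
  imports Defs "HOL-Combinatorics.Transposition"
begin

text \<open>
  The argument follows Jouannaud and Kirchner. A peak of a Peterson--Stickel step and a rewrite
  step is either parallel, or an overlap at a non-variable position of the upper left-hand side
  (LCCP), or lies below one of its variables (CVP), or has the rewrite step strictly inside the
  Peterson--Stickel redex (DCP). A peak of a Peterson--Stickel step and a single use of an equation
  is classified in the same way, except that an equation applied inside the redex is absorbed by
  matching modulo \<open>E\<close>; only equations above the redex give pairs.
  Hence all these local peaks are joinable. Well-founded induction along rewriting modulo then shows
  that any two Peterson--Stickel normal forms reachable from one term are \<open>E\<close>-equal.
  Conversely, each instance of a pair that satisfies its condition comes from a peak of rewriting
  modulo, so confluence makes it joinable.
\<close>

section \<open>Rewriting modulo a symmetric relation\<close>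

definition join_modulo ::
  "('a \<Rightarrow> 'a \<Rightarrow> bool) \<Rightarrow> ('a \<Rightarrow> 'a \<Rightarrow> bool) \<Rightarrow> 'a \<Rightarrow> 'a \<Rightarrow> bool" where
  "join_modulo Q P a b \<longleftrightarrow> (\<exists>u v. P\<^sup>*\<^sup>* a u \<and> P\<^sup>*\<^sup>* b v \<and> Q u v)"

lemma join_modulo_mono:
  "join_modulo Q P a b \<Longrightarrow> (\<And>u v. Q u v \<Longrightarrow> Q' u v) \<Longrightarrow> join_modulo Q' P a b"
  unfolding join_modulo_def by blast

locale rewriting_modulo =
  fixes E R P :: "'a \<Rightarrow> 'a \<Rightarrow> bool"
  assumes symp_E: "symp E"
    and R_imp_P: "R a b \<Longrightarrow> P a b"
    and P_imp_mod_step: "P a b \<Longrightarrow> (E\<^sup>*\<^sup>* OO R OO E\<^sup>*\<^sup>*) a b"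
    and wfp_mod_step: "wfp (E\<^sup>*\<^sup>* OO R OO E\<^sup>*\<^sup>*)\<inverse>\<inverse>"
    and local_confluence: "P a b \<Longrightarrow> R a c \<Longrightarrow> join_modulo E\<^sup>*\<^sup>* P b c"
    and local_coherence: "P a b \<Longrightarrow> E a c \<Longrightarrow> join_modulo E\<^sup>*\<^sup>* P b c"
begin

abbreviation equiv (infix "\<sim>" 50) where "(\<sim>) \<equiv> E\<^sup>*\<^sup>*"

abbreviation mod_step where "mod_step \<equiv> (\<sim>) OO R OO (\<sim>)"

abbreviation reach where "reach \<equiv> (sup P E)\<^sup>*\<^sup>*"

definition normal_form where "normal_form a \<longleftrightarrow> (\<nexists>b. P a b)"

definition unique_normal_form where
  "unique_normal_form a \<longleftrightarrow>
    (\<forall>m n. reach a m \<and> reach a n \<and> normal_form m \<and> normal_form n \<longrightarrow> m \<sim> n)"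

definition meet where "meet a b \<longleftrightarrow> (\<exists>c. reach a c \<and> reach b c)"

lemma equiv_sym: "a \<sim> b \<Longrightarrow> b \<sim> a"
  by (metis symp_E sympD symp_rtranclp)

lemma equiv_mod_step: "a \<sim> b \<Longrightarrow> mod_step b c \<Longrightarrow> mod_step a c"
  by (auto intro: rtranclp_trans)

lemma mod_step_equiv: "mod_step a b \<Longrightarrow> b \<sim> c \<Longrightarrow> mod_step a c"
  by (auto intro: rtranclp_trans)

lemma P_steps_reach: "P\<^sup>*\<^sup>* a b \<Longrightarrow> reach a b"
  by (metis (no_types) rtranclp_mono sup_ge1 predicate2D)

lemma equiv_reach: "a \<sim> b \<Longrightarrow> reach a b"
  by (metis (no_types) rtranclp_mono sup_ge2 predicate2D)

lemma mod_step_reach: "mod_step a b \<Longrightarrow> reach a b"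
  by (elim relcomppE) (meson R_imp_P P_steps_reach equiv_reach r_into_rtranclp rtranclp_trans)

lemma mod_steps_reach: "mod_step\<^sup>*\<^sup>* a b \<Longrightarrow> reach a b"
  by (induction rule: rtranclp_induct) (simp, meson mod_step_reach rtranclp_trans)

lemma reach_imp_equiv_or_mod_steps: "reach a b \<Longrightarrow> a \<sim> b \<or> mod_step\<^sup>+\<^sup>+ a b"
proof (induction rule: converse_rtranclp_induct)
  case (step a a')
  show ?case
  proof (cases "P a a'")
    case True
    then have "mod_step a a'" by (rule P_imp_mod_step)
    from step.IH show ?thesis
    proof
      assume "a' \<sim> b"
      then show ?thesis using mod_step_equiv[OF \<open>mod_step a a'\<close>] by blast
    next
      assume "mod_step\<^sup>+\<^sup>+ a' b"
      then show ?thesis using tranclp_into_tranclp2[of mod_step, OF \<open>mod_step a a'\<close>] by blast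
    qed
  next
    case False
    with step.hyps have "a \<sim> a'" by auto
    from step.IH show ?thesis
    proof
      assume "a' \<sim> b"
      with \<open>a \<sim> a'\<close> show ?thesis by (meson rtranclp_trans)
    next
      assume "mod_step\<^sup>+\<^sup>+ a' b"
      then obtain d where "mod_step a' d" "mod_step\<^sup>*\<^sup>* d b" by (blast dest: tranclpD)
      then show ?thesis
        using rtranclp_into_tranclp2[of mod_step, OF equiv_mod_step[OF \<open>a \<sim> a'\<close>]] by blast
    qed
  qed
qed auto

lemma mod_step_not_reach_back:
  assumes "mod_step a b"
  shows "\<not> reach b a"
proof
  assume "reach b a"
  from reach_imp_equiv_or_mod_steps[OF this] have "mod_step\<^sup>+\<^sup>+ a a"
  proof
    assume "b \<sim> a"
    then show ?thesis using mod_step_equiv[OF assms] by blast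
  next
    assume "mod_step\<^sup>+\<^sup>+ b a"
    then show ?thesis using tranclp_into_tranclp2[of mod_step, OF assms] by blast
  qed
  then have "(mod_step\<inverse>\<inverse>)\<^sup>+\<^sup>+ a a" by (rule tranclp_converseI[OF conversepI])
  with wfp_mod_step show False by (metis wfp_tranclp wfp_imp_irreflp irreflpD)
qed

lemma ex_normal_form: "\<exists>n. P\<^sup>*\<^sup>* a n \<and> normal_form n"
proof (induction a rule: wfp_induct_rule[OF wfp_mod_step, case_names less])
  case (less a)
  then show ?case
    unfolding normal_form_def
    by (meson P_imp_mod_step conversepI converse_rtranclp_into_rtranclp rtranclp.rtrancl_refl)
qed

lemma unique_normal_formD:
  "unique_normal_form a \<Longrightarrow> reach a m \<Longrightarrow> reach a n \<Longrightarrow> normal_form m \<Longrightarrow> normal_form n \<Longrightarrow> m \<sim> n"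
  unfolding unique_normal_form_def by blast

lemma meet_trans:
  assumes "meet a b" "meet b c" "unique_normal_form b"
  shows "meet a c"
proof -
  obtain d e where d: "reach a d" "reach b d" and e: "reach b e" "reach c e"
    using assms unfolding meet_def by blast
  obtain m n where m: "P\<^sup>*\<^sup>* d m" "normal_form m" and n: "P\<^sup>*\<^sup>* e n" "normal_form n"
    using ex_normal_form by metis
  have "reach b m" "reach b n"
    using d(2) e(1) m(1) n(1) P_steps_reach by (meson rtranclp_trans)+
  then have "m \<sim> n" using unique_normal_formD assms(3) m(2) n(2) by blast
  then have "reach a n" using d(1) m(1) P_steps_reach equiv_reach by (meson rtranclp_trans)
  moreover have "reach c n" using e(2) n(1) P_steps_reach by (meson rtranclp_trans)
  ultimately show ?thesis unfolding meet_def by blast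
qed

lemma join_modulo_meet: "join_modulo (\<sim>) P a b \<Longrightarrow> meet a b"
  unfolding join_modulo_def meet_def using P_steps_reach equiv_reach
  by (meson equiv_sym rtranclp_trans)

text \<open>If \<open>c\<close> took no step in the join, then \<open>b\<close> would lead back to \<open>a\<close>, against termination.\<close>

lemma coherence_step:
  assumes "P a b" "E a c"
  shows "\<exists>d. P c d \<and> meet b d"
proof -
  obtain u v where join: "P\<^sup>*\<^sup>* b u" "P\<^sup>*\<^sup>* c v" "u \<sim> v"
    using local_coherence[OF assms] unfolding join_modulo_def by blast
  have "reach b v" using P_steps_reach[OF join(1)] equiv_reach[OF join(3)] by (rule rtranclp_trans)
  from join(2) show ?thesis
  proof (cases rule: converse_rtranclpE)
    case base
    have "reach v a" using assms(2) base equiv_reach equiv_sym by blast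
    with \<open>reach b v\<close> have "reach b a" by (meson rtranclp_trans)
    with mod_step_not_reach_back P_imp_mod_step[OF assms(1)] show ?thesis by blast
  next
    case (step d)
    with \<open>reach b v\<close> show ?thesis unfolding meet_def using P_steps_reach by blast
  qed
qed

lemma coherence:
  assumes "x \<sim> y" "P x b" "a \<sim> x" and unique: "\<And>d. mod_step a d \<Longrightarrow> unique_normal_form d"
  shows "\<exists>d. P y d \<and> meet b d"
  using assms(1)
proof (induction rule: rtranclp_induct)
  case base
  then show ?case using assms(2) unfolding meet_def by blast
next
  case (step y z)
  then obtain d where d: "P y d" "meet b d" by blast
  obtain d' where d': "P z d'" "meet d d'" using coherence_step[OF d(1) step.hyps(2)] by blast
  have "a \<sim> y" using assms(3) step.hyps(1) by (rule rtranclp_trans)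
  then have "mod_step a d" using P_imp_mod_step[OF d(1)] by (rule equiv_mod_step)
  then show ?case using d' meet_trans[OF d(2) d'(2)] unique by blast
qed

lemma mod_step_peak_meet:
  assumes "mod_step a b" "mod_step a c" and unique: "\<And>d. mod_step a d \<Longrightarrow> unique_normal_form d"
  shows "meet b c"
proof -
  obtain x b' where b: "a \<sim> x" "R x b'" "b' \<sim> b" using assms(1) by blast
  obtain y c' where c: "a \<sim> y" "R y c'" "c' \<sim> c" using assms(2) by blast
  have "x \<sim> y" using b(1) c(1) equiv_sym by (meson rtranclp_trans)
  then obtain d where d: "P y d" "meet b' d"
    using coherence[OF _ R_imp_P[OF b(2)] b(1) unique] by blast
  have "meet d c'" using join_modulo_meet local_confluence[OF d(1) c(2)] by blast
  moreover have "unique_normal_form d"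
    using unique equiv_mod_step[OF c(1) P_imp_mod_step[OF d(1)]] .
  ultimately have "meet b' c'" using meet_trans d(2) by blast
  moreover have "reach b b'" "reach c c'" using b(3) c(3) equiv_reach equiv_sym by blast+
  ultimately show ?thesis unfolding meet_def by (meson rtranclp_trans)
qed

lemma equiv_normal_form_not_mod_step:
  assumes "a \<sim> n" "normal_form n" and unique: "\<And>d. mod_step a d \<Longrightarrow> unique_normal_form d"
  shows "\<not> mod_step a b"
proof
  assume "mod_step a b"
  then obtain x b' where x: "a \<sim> x" "R x b'" by blast
  have "x \<sim> n" using x(1) assms(1) equiv_sym by (meson rtranclp_trans)
  from coherence[OF this R_imp_P[OF x(2)] x(1) unique] show False
    using assms(2) unfolding normal_form_def by blast
qed

lemma unique_normal_form: "unique_normal_form a"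
proof (induction a rule: wfp_induct_rule[OF wfp_mod_step, case_names less])
  case (less a)
  then have unique: "unique_normal_form d" if "mod_step a d" for d using that by blast
  have "m \<sim> n" if mn: "reach a m" "reach a n" "normal_form m" "normal_form n" for m n
  proof -
    consider (equiv) "a \<sim> m" "a \<sim> n"
      | (steps) b c where "mod_step a b" "mod_step\<^sup>*\<^sup>* b m" "mod_step a c" "mod_step\<^sup>*\<^sup>* c n"
      using reach_imp_equiv_or_mod_steps mn equiv_normal_form_not_mod_step[OF _ _ unique]
      by (metis tranclpD)
    then show ?thesis
    proof cases
      case equiv
      then show ?thesis using equiv_sym by (meson rtranclp_trans)
    next
      case steps
      obtain d where d: "reach b d" "reach c d"
        using mod_step_peak_meet[OF steps(1,3) unique] unfolding meet_def by blast
      obtain k where k: "P\<^sup>*\<^sup>* d k" "normal_form k" using ex_normal_form by blast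
      have "reach b k" "reach c k" using d P_steps_reach[OF k(1)] by (meson rtranclp_trans)+
      then have "m \<sim> k" "k \<sim> n"
        using unique[OF steps(1)] unique[OF steps(3)] mod_steps_reach steps(2,4) mn(3,4) k(2)
          unique_normal_formD by blast+
      then show ?thesis by (rule rtranclp_trans)
    qed
  qed
  then show ?case unfolding unique_normal_form_def by blast
qed

theorem confluent_modulo:
  assumes "mod_step\<^sup>*\<^sup>* a b" "mod_step\<^sup>*\<^sup>* a c"
  shows "join_modulo (\<sim>) P b c"
proof -
  obtain m n where mn: "P\<^sup>*\<^sup>* b m" "normal_form m" "P\<^sup>*\<^sup>* c n" "normal_form n"
    using ex_normal_form by metis
  have "reach a m" "reach a n"
    using mod_steps_reach assms P_steps_reach mn(1,3) by (meson rtranclp_trans)+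
  then show ?thesis
    using unique_normal_formD[OF unique_normal_form] mn unfolding join_modulo_def by blast
qed

end

section \<open>Terms, contexts and substitutions\<close>

lemma active_poss_Nil [simp]: "[] \<in> active_poss \<mu> t"
  by (cases t) auto

lemma active_poss_subst: "p \<in> active_poss \<mu> t \<Longrightarrow> p \<in> active_poss \<mu> (subst \<sigma> t)"
  by (induction t p rule: subt_at.induct) auto

lemma subt_at_subst:
  "p \<in> active_poss \<mu> t \<Longrightarrow> subt_at (subst \<sigma> t) p = subst \<sigma> (subt_at t p)"
  by (induction t p rule: subt_at.induct) auto

lemma replace_at_subst:
  "p \<in> active_poss \<mu> t \<Longrightarrow> replace_at (subst \<sigma> t) p (subst \<sigma> u) = subst \<sigma> (replace_at t p u)"
  by (induction t p rule: subt_at.induct) (auto simp: map_update)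

inductive ctxt_closure ::
  "('f \<Rightarrow> nat set) \<Rightarrow> (('f, 'v) trm \<Rightarrow> ('f, 'v) trm \<Rightarrow> bool) \<Rightarrow> ('f, 'v) trm \<Rightarrow> ('f, 'v) trm \<Rightarrow> bool"
  for \<mu> T where
  root: "T s t \<Longrightarrow> ctxt_closure \<mu> T s t"
| arg: "i < length ts \<Longrightarrow> i \<in> \<mu> f \<Longrightarrow> ctxt_closure \<mu> T (ts ! i) u \<Longrightarrow>
    ctxt_closure \<mu> T (Fun f ts) (Fun f (ts[i := u]))"

lemma ctxt_closure_mono:
  "ctxt_closure \<mu> T s t \<Longrightarrow> (\<And>s t. T s t \<Longrightarrow> T' s t) \<Longrightarrow> ctxt_closure \<mu> T' s t"
  by (induction rule: ctxt_closure.induct) (auto intro: ctxt_closure.intros)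

lemma ctxt_closure_list_update:
  assumes "ctxt_closure \<mu> T s t" "i < length ts" "i \<in> \<mu> f"
  shows "ctxt_closure \<mu> T (Fun f (ts[i := s])) (Fun f (ts[i := t]))"
  using ctxt_closure.arg[of i "ts[i := s]" \<mu> f T t] assms by simp

lemma ctxt_closure_replace_at:
  "p \<in> active_poss \<mu> s \<Longrightarrow> ctxt_closure \<mu> T (subt_at s p) t \<Longrightarrow>
    ctxt_closure \<mu> T s (replace_at s p t)"
  by (induction s p rule: subt_at.induct) (auto intro: ctxt_closure.arg)

lemma ctxt_closure_iff_active_poss:
  "ctxt_closure \<mu> T s t \<longleftrightarrow>
    (\<exists>p \<in> active_poss \<mu> s. \<exists>u. T (subt_at s p) u \<and> t = replace_at s p u)"
  (is "_ \<longleftrightarrow> ?at_pos s t")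
proof
  show "ctxt_closure \<mu> T s t \<Longrightarrow> ?at_pos s t"
  proof (induction rule: ctxt_closure.induct)
    case (root s t)
    then show ?case by (intro bexI[of _ "[]"]) auto
  next
    case (arg i ts f u)
    then obtain p v where "p \<in> active_poss \<mu> (ts ! i)" "T (subt_at (ts ! i) p) v"
      "u = replace_at (ts ! i) p v" by blast
    with arg.hyps show ?case by (intro bexI[of _ "i # p"]) auto
  qed
qed (auto intro: ctxt_closure_replace_at ctxt_closure.root)

lemma symp_ctxt_closure:
  assumes "symp T"
  shows "symp (ctxt_closure \<mu> T)"
proof
  show "ctxt_closure \<mu> T t s" if "ctxt_closure \<mu> T s t" for s t
    using that
  proof (induction rule: ctxt_closure.induct)
    case (root s t)
    then show ?case using assms by (blast dest: sympD intro: ctxt_closure.root)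
  next
    case (arg i ts f u)
    from ctxt_closure_list_update[OF arg.IH arg.hyps(1), of f] show ?case using arg.hyps by simp
  qed
qed

lemma rtranclp_ctxt_closure_arg:
  assumes "(ctxt_closure \<mu> T)\<^sup>*\<^sup>* (ts ! i) u" "i < length ts" "i \<in> \<mu> f"
  shows "(ctxt_closure \<mu> T)\<^sup>*\<^sup>* (Fun f ts) (Fun f (ts[i := u]))"
  using assms(1)
proof (induction rule: rtranclp_induct)
  case base
  then show ?case by simp
next
  case (step u v)
  then show ?case
    using ctxt_closure_list_update[of \<mu> T u v i ts f] assms(2,3)
    by (meson rtranclp.rtrancl_into_rtrancl)
qed

lemma ctxt_closure_subst_cases:
  assumes "ctxt_closure \<mu> T (subst \<sigma> l) t"
  obtains (overlap) p u where "p \<in> active_poss \<mu> l" "\<nexists>x. subt_at l p = Var x"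
      "T (subst \<sigma> (subt_at l p)) u" "t = replace_at (subst \<sigma> l) p u"
    | (variable) p x u where "p \<in> active_poss \<mu> l" "subt_at l p = Var x"
      "ctxt_closure \<mu> T (\<sigma> x) u" "t = replace_at (subst \<sigma> l) p u"
  using assms
proof (induction l arbitrary: t thesis)
  case (Var x)
  from Var.prems(2)[of "[]" x t] Var.prems(3) show ?case by simp
next
  case (Fun f ls)
  from Fun.prems(3) have "ctxt_closure \<mu> T (Fun f (map (subst \<sigma>) ls)) t" by simp
  then show ?case
  proof cases
    case root
    then show ?thesis using Fun.prems(1)[of "[]" t] by simp
  next
    case (arg i u)
    then have i: "i < length ls" "ls ! i \<in> set ls" and step: "ctxt_closure \<mu> T (subst \<sigma> (ls ! i)) u"
      by simp_all
    show ?thesis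
    proof (rule Fun.IH[OF i(2) _ _ step])
      fix p v
      assume "p \<in> active_poss \<mu> (ls ! i)" "\<nexists>x. subt_at (ls ! i) p = Var x"
        "T (subst \<sigma> (subt_at (ls ! i) p)) v" "u = replace_at (subst \<sigma> (ls ! i)) p v"
      with arg i(1) show thesis using Fun.prems(1)[of "i # p" v] by simp
    next
      fix p x v
      assume "p \<in> active_poss \<mu> (ls ! i)" "subt_at (ls ! i) p = Var x"
        "ctxt_closure \<mu> T (\<sigma> x) v" "u = replace_at (subst \<sigma> (ls ! i)) p v"
      with arg i(1) show thesis using Fun.prems(2)[of "i # p" x v] by simp
    qed
  qed
qed

lemma wf_trm_list_update:
  "wf_trm \<R> (Fun f ts) \<Longrightarrow> wf_trm \<R> u \<Longrightarrow> wf_trm \<R> (Fun f (ts[i := u]))"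
  using set_update_subset_insert[of ts i u] by auto

lemma wf_trm_ctxt_closure:
  assumes "ctxt_closure \<mu> T s t" "wf_trm \<R> s" "\<And>s t. T s t \<Longrightarrow> wf_trm \<R> t"
  shows "wf_trm \<R> t"
  using assms(1,2)
proof (induction rule: ctxt_closure.induct)
  case (arg i ts f u)
  then show ?case by (intro wf_trm_list_update) auto
qed (rule assms(3))

lemma subst_cong: "(\<And>x. x \<in> vars t \<Longrightarrow> \<sigma> x = \<tau> x) \<Longrightarrow> subst \<sigma> t = subst \<tau> t"
  by (induction t) auto

lemma subst_atom_cong:
  "(\<And>x. x \<in> atom_vars A \<Longrightarrow> \<sigma> x = \<tau> x) \<Longrightarrow> subst_atom \<sigma> A = subst_atom \<tau> A"
  by (cases A) (auto intro!: subst_cong)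

lemma subst_rule_cong:
  assumes "\<forall>x \<in> rule_vars (l, r, c). \<sigma> x = \<tau> x"
  shows "subst \<sigma> l = subst \<tau> l" "subst \<sigma> r = subst \<tau> r"
    and "map (subst_atom \<sigma>) c = map (subst_atom \<tau>) c"
  using assms by (auto simp: rule_vars_def intro!: subst_cong subst_atom_cong)

lemma finite_vars: "finite (vars t)"
  by (induction t) auto

lemma finite_rule_vars: "finite (rule_vars \<alpha>)"
proof -
  have "finite (atom_vars A)" for A :: "('f, 'p, 'v) atom"
    by (cases A) (auto simp: finite_vars)
  then show ?thesis by (cases \<alpha>) (auto simp: rule_vars_def finite_vars)
qed

lemma subst_rename: "subst \<sigma> (subst (Var \<circ> \<pi>) t) = subst (\<sigma> \<circ> \<pi>) t"
  by (induction t) auto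

lemma subst_atom_rename: "subst_atom \<sigma> (subst_atom (Var \<circ> \<pi>) A) = subst_atom (\<sigma> \<circ> \<pi>) A"
  by (cases A) (auto simp: subst_rename)

lemma vars_rename: "vars (subst (Var \<circ> \<pi>) t) = \<pi> ` vars t"
  by (induction t) auto

lemma atom_vars_rename: "atom_vars (subst_atom (Var \<circ> \<pi>) A) = \<pi> ` atom_vars A"
  by (cases A) (auto simp: vars_rename)

lemma rule_vars_rename: "rule_vars (rename_rule \<pi> \<alpha>) = \<pi> ` rule_vars \<alpha>"
  by (cases \<alpha>) (auto simp: rule_vars_def rename_rule_def vars_rename atom_vars_rename)

lemma ex_bij_disjoint_image:
  fixes A B :: "'a :: infinite set"
  assumes "finite A" "finite B"
  shows "\<exists>\<pi>. bij \<pi> \<and> \<pi> ` B \<inter> A = {}"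
  using assms(2)
proof (induction B rule: finite_induct)
  case empty
  show ?case using bij_id by blast
next
  case (insert b B)
  then obtain \<pi> where \<pi>: "bij \<pi>" "\<pi> ` B \<inter> A = {}" by blast
  obtain b' where b': "b' \<notin> A \<union> \<pi> ` insert b B"
    using assms(1) insert.hyps(1) infinite_UNIV
    by (metis ex_new_if_finite finite_Un finite_imageI finite_insert)
  let ?\<pi> = "transpose (\<pi> b) b' \<circ> \<pi>"
  have "?\<pi> x = \<pi> x" if "x \<in> B" for x
    using that b' insert.hyps(2) \<pi>(1) by (auto simp: transpose_eq_iff dest: bij_is_inj injD)
  then have "?\<pi> ` insert b B \<inter> A = {}" using \<pi>(2) b' by auto
  moreover have "bij ?\<pi>" using \<pi>(1) by (simp add: bij_comp)
  ultimately show ?case by blast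
qed

lemma ex_renaming_apart:
  fixes A B :: "'v :: infinite set"
  assumes "finite A" "finite B" "wf_subst \<R> \<sigma>" "wf_subst \<R> \<tau>"
  obtains \<pi> \<rho> where "bij \<pi>" "A \<inter> \<pi> ` B = {}" "wf_subst \<R> \<rho>"
    "\<forall>x \<in> A. \<rho> x = \<sigma> x" "\<forall>x \<in> B. (\<rho> \<circ> \<pi>) x = \<tau> x"
proof -
  obtain \<pi> where \<pi>: "bij \<pi>" "\<pi> ` B \<inter> A = {}" using ex_bij_disjoint_image assms(1,2) by blast
  define \<rho> where "\<rho> x = (if x \<in> A then \<sigma> x else \<tau> (inv \<pi> x))" for x
  show thesis
  proof (rule that[of \<pi> \<rho>])
    show "A \<inter> \<pi> ` B = {}" using \<pi>(2) by blast
    show "wf_subst \<R> \<rho>" using assms(3,4) by (auto simp: wf_subst_def \<rho>_def)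
    show "\<forall>x \<in> B. (\<rho> \<circ> \<pi>) x = \<tau> x" using \<pi> by (auto simp: \<rho>_def bij_is_inj)
  qed (simp_all add: \<pi>(1) \<rho>_def)
qed

section \<open>Instances of conditional rules and pairs\<close>

definition cpair_inst ::
  "('f, 'p, 'v) egtrs \<Rightarrow> ('f, 'p, 'v) cpair set \<Rightarrow> ('f, 'v) trm \<Rightarrow> ('f, 'v) trm \<Rightarrow> bool" where
  "cpair_inst \<R> \<Pi> s t \<longleftrightarrow>
    (\<exists>(l, r, c) \<in> \<Pi>. \<exists>\<sigma>. satisfies \<R> \<sigma> c \<and> s = subst \<sigma> l \<and> t = subst \<sigma> r)"

definition crule_inst ::
  "('f, 'p, 'v) egtrs \<Rightarrow> ('f, 'p, 'v) crule set \<Rightarrow> ('f, 'v) trm \<Rightarrow> ('f, 'v) trm \<Rightarrow> bool" where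
  "crule_inst \<R> S s t \<longleftrightarrow>
    (\<exists>(l, r, c) \<in> S. \<exists>\<sigma>. satisfies \<R> \<sigma> (map Base c) \<and> s = subst \<sigma> l \<and> t = subst \<sigma> r)"

abbreviation root_step where "root_step \<R> \<equiv> crule_inst \<R> (rules (rm \<R>))"

abbreviation ps_root_step where "ps_root_step \<R> \<equiv> E_eq \<R> OO root_step \<R>"

definition E_step :: "('f, 'p, 'v) egtrs \<Rightarrow> ('f, 'v) trm \<Rightarrow> ('f, 'v) trm \<Rightarrow> bool" where
  "E_step \<R> = ctxt_closure (\<lambda>_. UNIV) (crule_inst \<R> (oriented_eqs \<R>))"

lemma cpair_instI:
  "(l, r, c) \<in> \<Pi> \<Longrightarrow> satisfies \<R> \<sigma> c \<Longrightarrow> cpair_inst \<R> \<Pi> (subst \<sigma> l) (subst \<sigma> r)"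
  unfolding cpair_inst_def by blast

lemma crule_instI:
  "(l, r, c) \<in> S \<Longrightarrow> satisfies \<R> \<sigma> (map Base c) \<Longrightarrow> crule_inst \<R> S (subst \<sigma> l) (subst \<sigma> r)"
  unfolding crule_inst_def by blast

lemma crule_instE:
  assumes "crule_inst \<R> S s t"
  obtains l r c \<sigma> where "(l, r, c) \<in> S" "satisfies \<R> \<sigma> (map Base c)" "s = subst \<sigma> l" "t = subst \<sigma> r"
  using assms unfolding crule_inst_def by blast

lemma cpair_inst_Un:
  "cpair_inst \<R> (\<Pi> \<union> \<Pi>') s t \<longleftrightarrow> cpair_inst \<R> \<Pi> s t \<or> cpair_inst \<R> \<Pi>' s t"
  unfolding cpair_inst_def by blast

lemma joinable_mod_iff_cpair_inst:
  "(\<forall>\<pi> \<in> \<Pi>. joinable_mod \<R> P \<pi>) \<longleftrightarrow> (\<forall>s t. cpair_inst \<R> \<Pi> s t \<longrightarrow> join_modulo (E_eq \<R>) P s t)"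
  unfolding joinable_mod_def cpair_inst_def join_modulo_def by blast

lemma satisfies_Cons: "satisfies \<R> \<sigma> (A # c) \<longleftrightarrow> sat_patom \<R> \<sigma> A \<and> satisfies \<R> \<sigma> c"
  unfolding satisfies_def by auto

lemma satisfies_append: "satisfies \<R> \<sigma> (c @ d) \<longleftrightarrow> satisfies \<R> \<sigma> c \<and> satisfies \<R> \<sigma> d"
  unfolding satisfies_def by auto

lemma satisfies_wf_subst: "satisfies \<R> \<sigma> c \<Longrightarrow> wf_subst \<R> \<sigma>"
  unfolding satisfies_def by blast

lemma satisfies_map_Base:
  "satisfies \<R> \<sigma> (map Base c) \<longleftrightarrow> wf_subst \<R> \<sigma> \<and> (\<forall>A \<in> set (map (subst_atom \<sigma>) c). ded (rm \<R>) A)"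
  unfolding satisfies_def by auto

lemma satisfies_rename:
  assumes "wf_subst \<R> \<sigma>"
  shows "satisfies \<R> \<sigma> (map Base (map (subst_atom (Var \<circ> \<pi>)) c)) \<longleftrightarrow>
    satisfies \<R> (\<sigma> \<circ> \<pi>) (map Base c)"
  unfolding satisfies_map_Base using assms by (auto simp: subst_atom_rename wf_subst_def)

lemma satisfies_cong:
  assumes "satisfies \<R> \<sigma> (map Base c)" "wf_subst \<R> \<tau>" "\<forall>x \<in> rule_vars (l, r, c). \<tau> x = \<sigma> x"
  shows "satisfies \<R> \<tau> (map Base c)"
  using assms(1,2) unfolding satisfies_map_Base subst_rule_cong(3)[OF assms(3)] by blast

lemma crule_inst_variants:
  assumes "crule_inst \<R> (variants S) s t"
  shows "crule_inst \<R> S s t"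
proof -
  obtain l r c \<sigma> where inst: "(l, r, c) \<in> variants S" "satisfies \<R> \<sigma> (map Base c)"
    "s = subst \<sigma> l" "t = subst \<sigma> r"
    using assms by (rule crule_instE)
  obtain \<pi> l' r' c' where "(l', r', c') \<in> S" and var: "l = subst (Var \<circ> \<pi>) l'"
    "r = subst (Var \<circ> \<pi>) r'" "c = map (subst_atom (Var \<circ> \<pi>)) c'"
    using inst(1) unfolding variants_def rename_rule_def by auto
  moreover have "satisfies \<R> (\<sigma> \<circ> \<pi>) (map Base c')"
    using inst(2) satisfies_rename satisfies_wf_subst var(3) by blast
  ultimately show ?thesis unfolding inst(3,4) var(1,2) subst_rename by (intro crule_instI)
qed

lemma crule_inst_variant_apart:
  fixes \<R> :: "('f, 'p, 'v :: infinite) egtrs"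
  assumes "crule_inst \<R> S s t" "finite A" "wf_subst \<R> \<sigma>"
  obtains l r c \<rho> where "(l, r, c) \<in> variants S" "A \<inter> rule_vars (l, r, c) = {}"
    "\<forall>x \<in> A. \<rho> x = \<sigma> x" "satisfies \<R> \<rho> (map Base c)" "s = subst \<rho> l" "t = subst \<rho> r"
proof -
  obtain l r c \<tau> where rule: "(l, r, c) \<in> S" "satisfies \<R> \<tau> (map Base c)"
    "s = subst \<tau> l" "t = subst \<tau> r"
    using assms(1) by (rule crule_instE)
  obtain \<pi> \<rho> where \<pi>: "bij \<pi>" "A \<inter> \<pi> ` rule_vars (l, r, c) = {}" and wf: "wf_subst \<R> \<rho>"
    and \<rho>: "\<forall>x \<in> A. \<rho> x = \<sigma> x" "\<forall>x \<in> rule_vars (l, r, c). (\<rho> \<circ> \<pi>) x = \<tau> x"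
    using ex_renaming_apart[OF assms(2) finite_rule_vars assms(3) satisfies_wf_subst[OF rule(2)]]
    by blast
  let ?l = "subst (Var \<circ> \<pi>) l" and ?r = "subst (Var \<circ> \<pi>) r"
    and ?c = "map (subst_atom (Var \<circ> \<pi>)) c"
  have rename: "rename_rule \<pi> (l, r, c) = (?l, ?r, ?c)" by (simp add: rename_rule_def)
  have "wf_subst \<R> (\<rho> \<circ> \<pi>)" using wf by (simp add: wf_subst_def)
  show thesis
  proof (rule that)
    show "(?l, ?r, ?c) \<in> variants S"
      using \<pi>(1) rule(1) unfolding variants_def rename[symmetric] by blast
    show "A \<inter> rule_vars (?l, ?r, ?c) = {}"
      using \<pi>(2) unfolding rename[symmetric] rule_vars_rename .
    show "satisfies \<R> \<rho> (map Base ?c)"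
      unfolding satisfies_rename[OF wf]
      using satisfies_cong[OF rule(2) \<open>wf_subst \<R> (\<rho> \<circ> \<pi>)\<close> \<rho>(2)] .
    show "s = subst \<rho> ?l" "t = subst \<rho> ?r"
      by (simp_all only: rule(3,4) subst_rename subst_rule_cong(1,2)[OF \<rho>(2)])
  qed (rule \<rho>(1))
qed

lemma rew_at_iff:
  "rew_at \<R> p s t \<longleftrightarrow> wf_trm \<R> s \<and> p \<in> active_poss (repl \<R>) s \<and>
    (\<exists>u. root_step \<R> (subt_at s p) u \<and> t = replace_at s p u)"
  unfolding rew_at_def crule_inst_def satisfies_map_Base by fastforce

lemma rew_iff: "rew \<R> s t \<longleftrightarrow> wf_trm \<R> s \<and> ctxt_closure (repl \<R>) (root_step \<R>) s t"
  unfolding rew_def rew_at_iff ctxt_closure_iff_active_poss by blast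

lemma ps_rew_iff: "ps_rew \<R> s t \<longleftrightarrow> wf_trm \<R> s \<and> ctxt_closure (repl \<R>) (ps_root_step \<R>) s t"
  unfolding ps_rew_def ctxt_closure_iff_active_poss crule_inst_def satisfies_map_Base relcompp_apply
  by fastforce

lemma inner_rew_rew: "inner_rew \<R> s t \<Longrightarrow> rew \<R> s t"
  unfolding inner_rew_def rew_def by blast

lemma inner_rew_arg:
  assumes "wf_trm \<R> (Fun f ts)" "i < length ts" "i \<in> repl \<R> f"
    and "ctxt_closure (repl \<R>) (root_step \<R>) (ts ! i) u"
  shows "inner_rew \<R> (Fun f ts) (Fun f (ts[i := u]))"
proof -
  obtain p v where "p \<in> active_poss (repl \<R>) (ts ! i)" "root_step \<R> (subt_at (ts ! i) p) v"
    "u = replace_at (ts ! i) p v"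
    using assms(4) unfolding ctxt_closure_iff_active_poss by blast
  then show ?thesis
    using assms(1-3) unfolding inner_rew_def rew_at_iff by (intro exI[of _ "i # p"]) auto
qed

section \<open>Rewriting modulo in a well-formed system\<close>

locale wf_egtrs =
  fixes \<R> :: "('f, 'p, 'v) egtrs"
  assumes egtrs: "is_egtrs \<R>"
begin

lemma E_eq_wf: "E_eq \<R> s t \<Longrightarrow> wf_trm \<R> s \<and> wf_trm \<R> t"
  using ded_Eq_wf[OF egtrs] unfolding E_eq_def by blast

lemma E_eq_refl: "wf_trm \<R> s \<Longrightarrow> E_eq \<R> s s"
  by (simp add: E_eq_def ded.eq_refl)

lemma E_eq_sym: "E_eq \<R> s t \<Longrightarrow> E_eq \<R> t s"
  unfolding E_eq_def by (rule ded.eq_sym)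

lemma E_eq_trans: "E_eq \<R> s t \<Longrightarrow> E_eq \<R> t u \<Longrightarrow> E_eq \<R> s u"
  unfolding E_eq_def by (rule ded.eq_trans)

lemma E_eq_arg:
  "wf_trm \<R> (Fun f ts) \<Longrightarrow> i < length ts \<Longrightarrow> E_eq \<R> (ts ! i) u \<Longrightarrow>
    E_eq \<R> (Fun f ts) (Fun f (ts[i := u]))"
  unfolding E_eq_def by (rule ded.eq_cong) auto

lemma ctxt_closure_E_eq: "ctxt_closure \<mu> (E_eq \<R>) s t \<Longrightarrow> wf_trm \<R> s \<Longrightarrow> E_eq \<R> s t"
  by (induction rule: ctxt_closure.induct) (auto intro: E_eq_arg)

lemma crule_inst_oriented_eqs_E_eq:
  assumes "crule_inst \<R> (oriented_eqs \<R>) s t"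
  shows "E_eq \<R> s t"
proof -
  obtain l r c \<sigma> where inst: "(l, r, c) \<in> oriented_eqs \<R>" "satisfies \<R> \<sigma> (map Base c)"
    "s = subst \<sigma> l" "t = subst \<sigma> r"
    using assms by (rule crule_instE)
  have "E_eq \<R> (subst \<sigma> l') (subst \<sigma> r')" if "(l', r', c) \<in> eqs \<R>" for l' r'
    using that inst(2) unfolding E_eq_def satisfies_map_Base
    by (intro ded.eq_clause[of _ _ c]) auto
  with inst E_eq_sym show ?thesis by (auto simp: oriented_eqs_def)
qed

lemma E_step_E_eq: "E_step \<R> s t \<Longrightarrow> wf_trm \<R> s \<Longrightarrow> E_eq \<R> s t"
  unfolding E_step_def
  by (rule ctxt_closure_E_eq[OF ctxt_closure_mono])
    (assumption, rule crule_inst_oriented_eqs_E_eq, assumption+)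

lemma symp_E_step: "symp (E_step \<R>)"
  unfolding E_step_def
proof (rule symp_ctxt_closure, rule sympI)
  show "crule_inst \<R> (oriented_eqs \<R>) t s" if "crule_inst \<R> (oriented_eqs \<R>) s t" for s t
    using that unfolding crule_inst_def oriented_eqs_def by blast
qed

lemma E_steps_sym: "(E_step \<R>)\<^sup>*\<^sup>* s t \<Longrightarrow> (E_step \<R>)\<^sup>*\<^sup>* t s"
  by (metis symp_E_step sympD symp_rtranclp)

lemma E_eq_imp_E_steps:
  assumes "E_eq \<R> s t"
  shows "(E_step \<R>)\<^sup>*\<^sup>* s t"
proof -
  have "A = Eq s t \<Longrightarrow> (E_step \<R>)\<^sup>*\<^sup>* s t" if "ded (rm \<R>) A" for A s t
    using that
  proof (induction arbitrary: s t rule: ded.induct)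
    case (eq_sym s t)
    then show ?case by (auto intro: E_steps_sym)
  next
    case (eq_trans s t u)
    then show ?case by (metis atom.inject(1) rtranclp_trans)
  next
    case (eq_cong f ts i u)
    then show ?case unfolding E_step_def by (auto intro!: rtranclp_ctxt_closure_arg)
  next
    case (eq_clause l r c \<sigma>)
    then have "crule_inst \<R> (oriented_eqs \<R>) (subst \<sigma> l) (subst \<sigma> r)"
      by (intro crule_instI[of _ _ c]) (auto simp: oriented_eqs_def satisfies_map_Base)
    then show ?case using eq_clause.prems by (auto simp: E_step_def intro: ctxt_closure.root)
  next
    case (horn_clause B c \<sigma>)
    then obtain Q ts where "B = Pred Q ts" using is_egtrs_horn_head[OF egtrs] by blast
    then show ?case using horn_clause.prems by simp
  qed auto
  then show ?thesis using assms unfolding E_eq_def by blast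
qed

lemma E_eq_iff_E_steps: "E_eq \<R> s t \<longleftrightarrow> wf_trm \<R> s \<and> (E_step \<R>)\<^sup>*\<^sup>* s t"
proof
  show "E_eq \<R> s t \<Longrightarrow> wf_trm \<R> s \<and> (E_step \<R>)\<^sup>*\<^sup>* s t"
    using E_eq_wf E_eq_imp_E_steps by blast
next
  assume "wf_trm \<R> s \<and> (E_step \<R>)\<^sup>*\<^sup>* s t"
  then have "(E_step \<R>)\<^sup>*\<^sup>* s t" "wf_trm \<R> s" by simp_all
  then show "E_eq \<R> s t"
    by (induction rule: rtranclp_induct)
      (auto intro: E_eq_refl E_eq_trans E_step_E_eq dest: E_eq_wf)
qed

lemma rules_rm_wf:
  assumes "(l, r, c) \<in> rules (rm \<R>)"
  shows "wf_trm \<R> l" "wf_trm \<R> r"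
proof -
  obtain c' where "(l, r, c') \<in> rules \<R>" using assms by (auto simp: rm_def)
  then have "(Step l r, c') \<in> clauses \<R>" by (simp add: clauses_def)
  then have "wf_atom \<R> (Step l r)" using egtrs unfolding is_egtrs_def by blast
  then show "wf_trm \<R> l" "wf_trm \<R> r" by simp_all
qed

lemma root_step_wf: "root_step \<R> s t \<Longrightarrow> wf_trm \<R> s \<and> wf_trm \<R> t"
  by (elim crule_instE) (simp add: rules_rm_wf wf_trm_subst satisfies_wf_subst)

lemma ps_rew_wf: "ps_rew \<R> s t \<Longrightarrow> wf_trm \<R> s \<and> wf_trm \<R> t"
  unfolding ps_rew_iff using wf_trm_ctxt_closure[of "repl \<R>" "ps_root_step \<R>"] root_step_wf
  by fast

lemma rew_ps_rew: "rew \<R> s t \<Longrightarrow> ps_rew \<R> s t"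
  unfolding rew_iff ps_rew_iff
  using ctxt_closure_mono[of _ "root_step \<R>" s t "ps_root_step \<R>"] E_eq_refl root_step_wf by blast

lemma ps_root_step_ps_rew: "ps_root_step \<R> s t \<Longrightarrow> ps_rew \<R> s t"
  unfolding ps_rew_iff using E_eq_wf by (blast intro: ctxt_closure.root)

lemma mod_rew_wf: "mod_rew \<R> s t \<Longrightarrow> wf_trm \<R> s \<and> wf_trm \<R> t"
  unfolding mod_rew_def using E_eq_wf by blast

lemma mod_rews_wf: "(mod_rew \<R>)\<^sup>*\<^sup>* s t \<Longrightarrow> wf_trm \<R> s \<Longrightarrow> wf_trm \<R> t"
  by (induction rule: rtranclp_induct) (auto dest: mod_rew_wf)

lemma ctxt_closure_ps_root_step:
  assumes "ctxt_closure \<mu> (ps_root_step \<R>) s t" "wf_trm \<R> s"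
  shows "\<exists>s'. E_eq \<R> s s' \<and> ctxt_closure \<mu> (root_step \<R>) s' t"
  using assms
proof (induction rule: ctxt_closure.induct)
  case (root s t)
  then show ?case by (auto intro: ctxt_closure.root)
next
  case (arg i ts f u)
  then obtain s' where s': "E_eq \<R> (ts ! i) s'" "ctxt_closure \<mu> (root_step \<R>) s' u" by auto
  have "E_eq \<R> (Fun f ts) (Fun f (ts[i := s']))" using E_eq_arg arg s'(1) by blast
  then show ?case using ctxt_closure_list_update[OF s'(2)] arg.hyps by blast
qed

lemma ps_rew_mod_rew:
  assumes "ps_rew \<R> s t"
  shows "mod_rew \<R> s t"
proof -
  obtain s' where "E_eq \<R> s s'" "rew \<R> s' t"
    using assms ctxt_closure_ps_root_step E_eq_wf unfolding ps_rew_iff rew_iff by blast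
  then show ?thesis using E_eq_refl ps_rew_wf[OF assms] unfolding mod_rew_def by blast
qed

lemma ps_rews_mod_rews: "(ps_rew \<R>)\<^sup>*\<^sup>* s t \<Longrightarrow> (mod_rew \<R>)\<^sup>*\<^sup>* s t"
  by (metis (no_types) ps_rew_mod_rew mono_rtranclp)

lemma mod_rew_eq_E_steps: "mod_rew \<R> = (E_step \<R>)\<^sup>*\<^sup>* OO rew \<R> OO (E_step \<R>)\<^sup>*\<^sup>*"
proof (intro ext iffI)
  show "((E_step \<R>)\<^sup>*\<^sup>* OO rew \<R> OO (E_step \<R>)\<^sup>*\<^sup>*) s t" if "mod_rew \<R> s t" for s t
    using that E_eq_imp_E_steps unfolding mod_rew_def by blast
next
  fix s t
  assume "((E_step \<R>)\<^sup>*\<^sup>* OO rew \<R> OO (E_step \<R>)\<^sup>*\<^sup>*) s t"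
  then obtain u v where steps: "(E_step \<R>)\<^sup>*\<^sup>* s u" "rew \<R> u v" "(E_step \<R>)\<^sup>*\<^sup>* v t" by blast
  have "(E_step \<R>)\<^sup>*\<^sup>* u s" using steps(1) by (rule E_steps_sym)
  moreover have "wf_trm \<R> u" "wf_trm \<R> v" using ps_rew_wf rew_ps_rew steps(2) by blast+
  ultimately show "mod_rew \<R> s t"
    using E_eq_iff_E_steps E_eq_sym steps unfolding mod_rew_def by blast
qed

lemma ps_rew_arg:
  assumes "ps_rew \<R> s t" "wf_trm \<R> (Fun f ts)" "i < length ts" "i \<in> repl \<R> f"
  shows "ps_rew \<R> (Fun f (ts[i := s])) (Fun f (ts[i := t]))"
proof -
  have "wf_trm \<R> s" "ctxt_closure (repl \<R>) (ps_root_step \<R>) s t"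
    using assms(1) unfolding ps_rew_iff by simp_all
  then show ?thesis
    using wf_trm_list_update[OF assms(2)] assms(3,4)
    unfolding ps_rew_iff by (blast intro: ctxt_closure_list_update)
qed

lemma ps_rews_arg:
  assumes "(ps_rew \<R>)\<^sup>*\<^sup>* s t" "wf_trm \<R> (Fun f ts)" "i < length ts" "i \<in> repl \<R> f"
  shows "(ps_rew \<R>)\<^sup>*\<^sup>* (Fun f (ts[i := s])) (Fun f (ts[i := t]))"
  using assms(1)
  by (induction rule: rtranclp_induct) (auto intro: rtranclp.rtrancl_into_rtrancl ps_rew_arg assms)

abbreviation ps_joinable where "ps_joinable \<equiv> join_modulo (E_eq \<R>) (ps_rew \<R>)"

lemma ps_joinable_arg:
  assumes "ps_joinable s t" "wf_trm \<R> (Fun f ts)" "i < length ts" "i \<in> repl \<R> f"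
  shows "ps_joinable (Fun f (ts[i := s])) (Fun f (ts[i := t]))"
proof -
  obtain u v where join: "(ps_rew \<R>)\<^sup>*\<^sup>* s u" "(ps_rew \<R>)\<^sup>*\<^sup>* t v" "E_eq \<R> u v"
    using assms(1) unfolding join_modulo_def by blast
  have "wf_trm \<R> (Fun f (ts[i := u]))"
    using wf_trm_list_update[OF assms(2)] E_eq_wf[OF join(3)] by blast
  from E_eq_arg[OF this, of i v] have "E_eq \<R> (Fun f (ts[i := u])) (Fun f (ts[i := v]))"
    using join(3) assms(3) by simp
  then show ?thesis
    unfolding join_modulo_def
    using ps_rews_arg[OF join(1) assms(2-)] ps_rews_arg[OF join(2) assms(2-)] by blast
qed

text \<open>
  The assumption \<open>absorb\<close> is what rewrite steps and equation steps have in common: the former are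
  Peterson--Stickel steps, the latter \<open>E\<close>-equalities.
\<close>

lemma parallel_peak_joinable:
  assumes wf: "wf_trm \<R> (Fun f ts)" and "i < length ts" "j < length ts" "i \<noteq> j"
    and ps: "i \<in> repl \<R> f" "ps_rew \<R> (ts ! i) u"
    and step: "j \<in> \<nu> f" "ctxt_closure \<nu> T (ts ! j) v"
    and absorb: "\<And>s t. wf_trm \<R> s \<Longrightarrow> ctxt_closure \<nu> T s t \<Longrightarrow> ((ps_rew \<R>)\<^sup>*\<^sup>* OO E_eq \<R>) s t"
  shows "ps_joinable (Fun f (ts[i := u])) (Fun f (ts[j := v]))"
proof -
  have "wf_trm \<R> (ts ! j)" using wf \<open>j < length ts\<close> by simp
  then have "wf_trm \<R> v" using absorb[OF _ step(2)] E_eq_wf by blast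
  from wf_trm_list_update[OF wf this] have "wf_trm \<R> (Fun f (ts[j := v]))" .
  moreover have "ts[j := v, i := ts ! i] = ts[j := v]"
    using \<open>i \<noteq> j\<close> by (metis list_update_id nth_list_update_neq)
  ultimately have "ps_rew \<R> (Fun f (ts[j := v])) (Fun f (ts[j := v, i := u]))"
    using ps_rew_arg[OF ps(2), of f "ts[j := v]" i] ps(1) \<open>i < length ts\<close> by simp
  then have "ps_rew \<R> (Fun f (ts[j := v])) (Fun f (ts[i := u, j := v]))"
    using \<open>i \<noteq> j\<close> by (simp add: list_update_swap)
  moreover have "ctxt_closure \<nu> T (Fun f (ts[i := u])) (Fun f (ts[i := u, j := v]))"
    using ctxt_closure.arg[of j "ts[i := u]" \<nu> f T v] step \<open>j < length ts\<close> \<open>i \<noteq> j\<close> by simp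
  then have "((ps_rew \<R>)\<^sup>*\<^sup>* OO E_eq \<R>) (Fun f (ts[i := u])) (Fun f (ts[i := u, j := v]))"
    using absorb wf_trm_list_update[OF wf] ps_rew_wf[OF ps(2)] by blast
  ultimately show ?thesis unfolding join_modulo_def by blast
qed

lemma ps_rew_ctxt_closure_peak_joinable:
  assumes absorb: "\<And>s t. wf_trm \<R> s \<Longrightarrow> ctxt_closure \<nu> T s t \<Longrightarrow> ((ps_rew \<R>)\<^sup>*\<^sup>* OO E_eq \<R>) s t"
    and ps_root: "\<And>s t s'. wf_trm \<R> s \<Longrightarrow> ps_root_step \<R> s t \<Longrightarrow> ctxt_closure \<nu> T s s' \<Longrightarrow>
      ps_joinable t s'"
    and T_root: "\<And>s t s'. ps_rew \<R> s t \<Longrightarrow> T s s' \<Longrightarrow> ps_joinable t s'"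
    and "ps_rew \<R> s t" "ctxt_closure \<nu> T s s'"
  shows "ps_joinable t s'"
  using assms(5,4)
proof (induction arbitrary: t rule: ctxt_closure.induct)
  case (root s s')
  then show ?case by (intro T_root)
next
  case (arg j ts f v)
  then have wf: "wf_trm \<R> (Fun f ts)" and "ctxt_closure (repl \<R>) (ps_root_step \<R>) (Fun f ts) t"
    unfolding ps_rew_iff by simp_all
  from this(2) show ?case
  proof cases
    case root
    show ?thesis by (rule ps_root[OF wf root ctxt_closure.arg[OF arg.hyps]])
  next
    case inner: (arg i u)
    then have ps: "ps_rew \<R> (ts ! i) u" using wf unfolding ps_rew_iff by simp
    show ?thesis
    proof (cases "i = j")
      case True
      then show ?thesis using ps_joinable_arg[OF arg.IH wf] ps inner by simp
    next
      case False
      show ?thesis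
        unfolding inner(1)
        by (rule parallel_peak_joinable[OF wf inner(2) arg.hyps(1) False inner(3) ps arg.hyps(2,3)
              absorb])
    qed
  qed
qed

end

section \<open>Local peaks and conditional pairs\<close>

lemma overlap_cpair_inst:
  fixes \<R> :: "('f, 'p, 'v :: infinite) egtrs"
  assumes rule: "(l, r, c) \<in> S" "satisfies \<R> \<sigma> (map Base c)"
    and p: "p \<in> active_poss (repl \<R>) l" "\<nexists>x. subt_at l p = Var x"
    and step: "(E_eq \<R> OO crule_inst \<R> S') (subst \<sigma> (subt_at l p)) t"
  shows "cpair_inst \<R> (LCCPs \<R> S S') (replace_at (subst \<sigma> l) p t) (subst \<sigma> r)"
proof -
  obtain u where eq: "E_eq \<R> (subst \<sigma> (subt_at l p)) u" and inst: "crule_inst \<R> S' u t"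
    using step by blast
  obtain l' r' c' \<rho> where variant: "(l', r', c') \<in> variants S'"
    "rule_vars (l, r, c) \<inter> rule_vars (l', r', c') = {}"
    and \<rho>: "\<forall>x \<in> rule_vars (l, r, c). \<rho> x = \<sigma> x"
    and sat': "satisfies \<R> \<rho> (map Base c')" and inst': "u = subst \<rho> l'" "t = subst \<rho> r'"
    using crule_inst_variant_apart[OF inst finite_rule_vars satisfies_wf_subst[OF rule(2)]]
    by blast
  note cong = subst_rule_cong[OF \<rho>]
  let ?cond = "Base (Eq (subt_at l p) l') # map Base c @ map Base c'"
  have "subst \<rho> (subt_at l p) = subst \<sigma> (subt_at l p)"
    using cong(1) subt_at_subst[OF p(1)] by metis
  moreover have "satisfies \<R> \<rho> (map Base c)"
    using satisfies_cong[OF rule(2) satisfies_wf_subst[OF sat'] \<rho>] .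
  ultimately have sat: "satisfies \<R> \<rho> ?cond"
    using eq sat' by (simp add: satisfies_Cons satisfies_append inst'(1) E_eq_def)
  then have "feasible \<R> (replace_at l p r', r, ?cond)" unfolding feasible_def by blast
  then have "(replace_at l p r', r, ?cond) \<in> LCCPs \<R> S S'"
    using rule(1) p variant unfolding LCCPs_def by blast
  from cpair_instI[OF this sat] show ?thesis
    using cong(1,2) replace_at_subst[OF p(1), of \<rho> r'] inst'(2) by simp
qed

lemma LCCPs_inst_peak:
  assumes "cpair_inst \<R> (LCCPs \<R> S S') t s'"
  shows "\<exists>s. crule_inst \<R> S s s' \<and> ctxt_closure (repl \<R>) (E_eq \<R> OO crule_inst \<R> S') s t"
proof -
  obtain l r c l' r' c' p \<sigma> where rules: "(l, r, c) \<in> S" "(l', r', c') \<in> variants S'"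
    and p: "p \<in> active_poss (repl \<R>) l"
    and inst: "t = subst \<sigma> (replace_at l p r')" "s' = subst \<sigma> r"
    and "satisfies \<R> \<sigma> (Base (Eq (subt_at l p) l') # map Base c @ map Base c')"
    using assms unfolding cpair_inst_def LCCPs_def by blast
  then have eq: "E_eq \<R> (subt_at (subst \<sigma> l) p) (subst \<sigma> l')"
    and sats: "satisfies \<R> \<sigma> (map Base c)" "satisfies \<R> \<sigma> (map Base c')"
    by (simp_all add: satisfies_Cons satisfies_append E_eq_def subt_at_subst[OF p])
  have "crule_inst \<R> S' (subst \<sigma> l') (subst \<sigma> r')"
    using crule_inst_variants[OF crule_instI[OF rules(2) sats(2)]] .
  with eq have "ctxt_closure (repl \<R>) (E_eq \<R> OO crule_inst \<R> S') (subst \<sigma> l) t"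
    unfolding inst(1) replace_at_subst[OF p, symmetric]
    by (intro ctxt_closure_replace_at active_poss_subst p ctxt_closure.root relcomppI)
  moreover have "crule_inst \<R> S (subst \<sigma> l) s'"
    unfolding inst(2) using crule_instI[OF rules(1) sats(1)] .
  ultimately show ?thesis by blast
qed

lemma CVPs_inst_peak:
  assumes "cpair_inst \<R> (CVPs \<R> S) t s'"
  shows "\<exists>s. crule_inst \<R> S s s' \<and> ctxt_closure (repl \<R>) (ps_root_step \<R>) s t"
proof -
  obtain l r c p x x' \<sigma> where rule: "(l, r, c) \<in> S"
    and p: "p \<in> active_poss (repl \<R>) l" "subt_at l p = Var x"
    and sat: "satisfies \<R> \<sigma> (PSStep (Var x) (Var x') # map Base c)"
    and inst: "t = subst \<sigma> (replace_at l p (Var x'))" "s' = subst \<sigma> r"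
    using assms unfolding cpair_inst_def CVPs_def by blast
  have "ctxt_closure (repl \<R>) (ps_root_step \<R>) (subt_at (subst \<sigma> l) p) (subst \<sigma> (Var x'))"
    using sat p(2) by (simp add: satisfies_Cons ps_rew_iff subt_at_subst[OF p(1)])
  then have "ctxt_closure (repl \<R>) (ps_root_step \<R>) (subst \<sigma> l) t"
    unfolding inst(1) replace_at_subst[OF p(1), symmetric]
    by (intro ctxt_closure_replace_at active_poss_subst p(1))
  moreover have "crule_inst \<R> S (subst \<sigma> l) s'"
    unfolding inst(2) using crule_instI[OF rule] sat by (simp add: satisfies_Cons)
  ultimately show ?thesis by blast
qed

lemma DCP_inst_peak:
  assumes "cpair_inst \<R> (DCP \<R>) t s'"
  shows "\<exists>s. ps_root_step \<R> s t \<and> inner_rew \<R> s s'"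
proof -
  obtain l r c x x' \<sigma> where rule: "(l, r, c) \<in> rules (rm \<R>)"
    and sat: "satisfies \<R> \<sigma> (Base (Eq (Var x) l) # InnerStep (Var x) (Var x') # map Base c)"
    and inst: "t = subst \<sigma> r" "s' = subst \<sigma> (Var x')"
    using assms unfolding cpair_inst_def DCP_def by blast
  have "E_eq \<R> (\<sigma> x) (subst \<sigma> l)" "inner_rew \<R> (\<sigma> x) s'"
    using sat inst(2) by (simp_all add: satisfies_Cons E_eq_def)
  moreover have "root_step \<R> (subst \<sigma> l) t"
    unfolding inst(1) using crule_instI[OF rule] sat by (simp add: satisfies_Cons)
  ultimately show ?thesis by blast
qed

context wf_egtrs
begin

lemma root_peak_mod_rew:
  assumes "root_step \<R> s s'" "ctxt_closure (repl \<R>) (ps_root_step \<R>) s t"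
  shows "mod_rew \<R> s t \<and> mod_rew \<R> s s'"
proof
  have "wf_trm \<R> s" using assms(1) root_step_wf by blast
  then show "mod_rew \<R> s t" using assms(2) ps_rew_mod_rew unfolding ps_rew_iff by blast
  show "mod_rew \<R> s s'"
    using assms(1) E_eq_refl[OF \<open>wf_trm \<R> s\<close>] ps_root_step_ps_rew ps_rew_mod_rew by blast
qed

lemma cpair_inst_mod_rew_peak:
  assumes "cpair_inst \<R> (LCCP \<R> \<union> CVP_ps \<R> \<union> DCP \<R>) t s'"
  shows "\<exists>s. mod_rew \<R> s t \<and> mod_rew \<R> s s'"
proof -
  consider (LCCP) "cpair_inst \<R> (LCCP \<R>) t s'" | (CVP) "cpair_inst \<R> (CVP_ps \<R>) t s'"
    | (DCP) "cpair_inst \<R> (DCP \<R>) t s'"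
    using assms unfolding cpair_inst_Un by blast
  then show ?thesis
  proof cases
    case LCCP
    then show ?thesis using LCCPs_inst_peak root_peak_mod_rew unfolding LCCP_def by blast
  next
    case CVP
    then show ?thesis using CVPs_inst_peak root_peak_mod_rew unfolding CVP_ps_def by blast
  next
    case DCP
    then obtain s where "ps_root_step \<R> s t" "inner_rew \<R> s s'" using DCP_inst_peak by blast
    then have "ps_rew \<R> s t" "ps_rew \<R> s s'"
      using ps_root_step_ps_rew inner_rew_rew rew_ps_rew by blast+
    then show ?thesis using ps_rew_mod_rew by blast
  qed
qed

theorem E_confluent_imp_pairs_joinable:
  assumes "E_confluent \<R>"
  shows "\<forall>\<pi> \<in> LCCP \<R> \<union> CVP_ps \<R> \<union> DCP \<R>. joinable_mod \<R> (mod_rew \<R>) \<pi>"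
  unfolding joinable_mod_iff_cpair_inst
proof (intro allI impI)
  fix t t'
  assume "cpair_inst \<R> (LCCP \<R> \<union> CVP_ps \<R> \<union> DCP \<R>) t t'"
  then obtain s where "mod_rew \<R> s t" "mod_rew \<R> s t'" using cpair_inst_mod_rew_peak by blast
  then show "join_modulo (E_eq \<R>) (mod_rew \<R>) t t'"
    using assms mod_rew_wf unfolding E_confluent_def join_modulo_def by blast
qed

end

locale infinite_egtrs = wf_egtrs \<R> for \<R> :: "('f, 'p, 'v :: infinite) egtrs"
begin

lemma variable_overlap_cpair_inst:
  assumes rule: "(l, r, c) \<in> S" "satisfies \<R> \<sigma> (map Base c)"
    and p: "p \<in> active_poss (repl \<R>) l" "subt_at l p = Var x"
    and step: "ps_rew \<R> (\<sigma> x) t"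
  shows "cpair_inst \<R> (CVPs \<R> S) (replace_at (subst \<sigma> l) p t) (subst \<sigma> r)"
proof -
  obtain x' where x': "x' \<notin> rule_vars (l, r, c)"
    using finite_rule_vars infinite_UNIV ex_new_if_finite by metis
  define \<rho> where "\<rho> = \<sigma>(x' := t)"
  then have agree: "\<forall>y \<in> rule_vars (l, r, c). \<rho> y = \<sigma> y" using x' by auto
  note cong = subst_rule_cong[OF agree]
  have "subst \<rho> (Var x) = subst \<sigma> (Var x)" using cong(1) subt_at_subst[OF p(1)] p(2) by metis
  then have "\<rho> x = \<sigma> x" "\<rho> x' = t" by (simp_all add: \<rho>_def)
  let ?cond = "PSStep (Var x) (Var x') # map Base c"
  have "wf_subst \<R> \<rho>"
    using satisfies_wf_subst[OF rule(2)] ps_rew_wf[OF step] by (simp add: wf_subst_def \<rho>_def)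
  then have "satisfies \<R> \<rho> (map Base c)" using satisfies_cong[OF rule(2)] agree by blast
  then have sat: "satisfies \<R> \<rho> ?cond"
    using step \<open>\<rho> x = \<sigma> x\<close> \<open>\<rho> x' = t\<close> by (simp add: satisfies_Cons)
  then have "(replace_at l p (Var x'), r, ?cond) \<in> CVPs \<R> S"
    using rule(1) p x' unfolding CVPs_def feasible_def by blast
  from cpair_instI[OF this sat] show ?thesis
    using cong(1,2) replace_at_subst[OF p(1), of \<rho> "Var x'"] \<open>\<rho> x' = t\<close> by simp
qed

lemma root_peak_cpair_inst:
  assumes "crule_inst \<R> S s s'" "ctxt_closure (repl \<R>) (ps_root_step \<R>) s t"
  shows "cpair_inst \<R> (LCCPs \<R> S (rules (rm \<R>)) \<union> CVPs \<R> S) t s'"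
proof -
  obtain l r c \<sigma> where rule: "(l, r, c) \<in> S" "satisfies \<R> \<sigma> (map Base c)"
    and s: "s = subst \<sigma> l" and s': "s' = subst \<sigma> r"
    using assms(1) by (rule crule_instE)
  from assms(2) show ?thesis
    unfolding s
  proof (cases rule: ctxt_closure_subst_cases)
    case (overlap p u)
    from overlap_cpair_inst[OF rule overlap(1-3)] show ?thesis
      unfolding s' overlap(4) cpair_inst_Un ..
  next
    case (variable p x u)
    then have "ps_rew \<R> (\<sigma> x) u"
      using satisfies_wf_subst[OF rule(2)] unfolding ps_rew_iff wf_subst_def by blast
    from variable_overlap_cpair_inst[OF rule variable(1,2) this] show ?thesis
      unfolding s' variable(4) cpair_inst_Un ..
  qed
qed

lemma inner_peak_cpair_inst:
  assumes "ps_root_step \<R> s t" "inner_rew \<R> s s'"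
  shows "cpair_inst \<R> (DCP \<R>) t s'"
proof -
  obtain l r c \<sigma> where rule: "(l, r, c) \<in> rules (rm \<R>)" "satisfies \<R> \<sigma> (map Base c)"
    and eq: "E_eq \<R> s (subst \<sigma> l)" and t: "t = subst \<sigma> r"
    using assms(1) by (auto elim: crule_instE)
  obtain x where x: "x \<notin> rule_vars (l, r, c)"
    using finite_rule_vars infinite_UNIV ex_new_if_finite by metis
  obtain x' where x': "x' \<notin> insert x (rule_vars (l, r, c))"
    using finite_rule_vars infinite_UNIV ex_new_if_finite finite_insert by metis
  define \<rho> where "\<rho> = \<sigma>(x := s, x' := s')"
  then have "\<rho> x = s" "\<rho> x' = s'" using x' by auto
  have agree: "\<forall>y \<in> rule_vars (l, r, c). \<rho> y = \<sigma> y" using x x' by (auto simp: \<rho>_def)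
  note cong = subst_rule_cong[OF agree]
  let ?cond = "Base (Eq (Var x) l) # InnerStep (Var x) (Var x') # map Base c"
  have "wf_trm \<R> s" "wf_trm \<R> s'"
    using ps_rew_wf rew_ps_rew inner_rew_rew assms(2) by blast+
  then have "wf_subst \<R> \<rho>"
    using satisfies_wf_subst[OF rule(2)] by (simp add: wf_subst_def \<rho>_def)
  then have "satisfies \<R> \<rho> (map Base c)" using satisfies_cong[OF rule(2)] agree by blast
  then have sat: "satisfies \<R> \<rho> ?cond"
    using eq assms(2) \<open>\<rho> x = s\<close> \<open>\<rho> x' = s'\<close> by (simp add: satisfies_Cons E_eq_def cong(1))
  then have "feasible \<R> (r, Var x', ?cond)" unfolding feasible_def by blast
  then have "(r, Var x', ?cond) \<in> DCP \<R>"
    using rule(1) x x' unfolding DCP_def mem_Collect_eq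
    by (intro conjI exI[of _ l] exI[of _ r] exI[of _ c] exI[of _ x] exI[of _ x']) auto
  from cpair_instI[OF this sat] show ?thesis using t cong(2) \<open>\<rho> x' = s'\<close> by simp
qed

lemma root_peak_ps_joinable:
  assumes "\<forall>\<pi> \<in> LCCPs \<R> S (rules (rm \<R>)) \<union> CVPs \<R> S. joinable_mod \<R> (ps_rew \<R>) \<pi>"
    and "ps_rew \<R> s t" "crule_inst \<R> S s s'"
  shows "ps_joinable t s'"
  using assms root_peak_cpair_inst unfolding joinable_mod_iff_cpair_inst ps_rew_iff by blast

lemma ps_rew_E_step_peak_joinable:
  assumes "\<forall>\<pi> \<in> LCCP_E \<R> \<union> CVP_ps_E \<R>. joinable_mod \<R> (ps_rew \<R>) \<pi>"
    and "ps_rew \<R> s t" "E_step \<R> s s'"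
  shows "ps_joinable t s'"
proof (rule ps_rew_ctxt_closure_peak_joinable[OF _ _ _ assms(2) assms(3)[unfolded E_step_def]],
    fold E_step_def)
  show "((ps_rew \<R>)\<^sup>*\<^sup>* OO E_eq \<R>) s t" if "wf_trm \<R> s" "E_step \<R> s t" for s t
    using E_step_E_eq that by blast
next
  fix s t s'
  assume "wf_trm \<R> s" "ps_root_step \<R> s t" "E_step \<R> s s'"
  then have "E_eq \<R> s' s" using E_step_E_eq E_eq_sym by blast
  with \<open>ps_root_step \<R> s t\<close> have "ps_root_step \<R> s' t" using E_eq_trans by blast
  then have "ps_rew \<R> s' t" by (rule ps_root_step_ps_rew)
  then show "ps_joinable t s'" using E_eq_refl ps_rew_wf unfolding join_modulo_def by blast
next
  show "ps_joinable t s'" if "ps_rew \<R> s t" "crule_inst \<R> (oriented_eqs \<R>) s s'" for s t s'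
    using root_peak_ps_joinable assms(1) that unfolding LCCP_E_def CVP_ps_E_def by blast
qed

lemma ps_rew_rew_peak_joinable:
  assumes pairs: "\<forall>\<pi> \<in> LCCP \<R> \<union> CVP_ps \<R> \<union> DCP \<R>. joinable_mod \<R> (ps_rew \<R>) \<pi>"
    and "ps_rew \<R> s t" "rew \<R> s s'"
  shows "ps_joinable t s'"
proof -
  have root_peak: "ps_joinable t s'" if "ps_rew \<R> s t" "root_step \<R> s s'" for s t s'
    using root_peak_ps_joinable pairs that unfolding LCCP_def CVP_ps_def by blast
  have DCP: "ps_joinable t s'" if "cpair_inst \<R> (DCP \<R>) t s'" for t s'
    using that pairs unfolding joinable_mod_iff_cpair_inst cpair_inst_Un by blast
  have "ctxt_closure (repl \<R>) (root_step \<R>) s s'" using assms(3) unfolding rew_iff by blast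
  from _ _ root_peak assms(2) this show ?thesis
  proof (rule ps_rew_ctxt_closure_peak_joinable)
    fix s t
    assume "wf_trm \<R> s" "ctxt_closure (repl \<R>) (root_step \<R>) s t"
    then have "ps_rew \<R> s t" using rew_ps_rew rew_iff by blast
    then show "((ps_rew \<R>)\<^sup>*\<^sup>* OO E_eq \<R>) s t" using E_eq_refl ps_rew_wf by blast
  next
    fix s t s'
    assume "wf_trm \<R> s" "ps_root_step \<R> s t" and step: "ctxt_closure (repl \<R>) (root_step \<R>) s s'"
    from step show "ps_joinable t s'"
    proof cases
      case root
      have "ps_rew \<R> s t" using \<open>ps_root_step \<R> s t\<close> by (rule ps_root_step_ps_rew)
      then show ?thesis using root_peak root by blast
    next
      case (arg i ts f u)
      then have "inner_rew \<R> s s'"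
        using inner_rew_arg[of \<R> f ts i u] \<open>wf_trm \<R> s\<close> by simp
      then show ?thesis using DCP \<open>ps_root_step \<R> s t\<close> inner_peak_cpair_inst by blast
    qed
  qed
qed

theorem pairs_joinable_imp_E_confluent:
  assumes terminating: "E_terminating \<R>"
    and pairs: "\<forall>\<pi> \<in> LCCP \<R> \<union> CVP_ps \<R> \<union> DCP \<R> \<union> LCCP_E \<R> \<union> CVP_ps_E \<R>.
      joinable_mod \<R> (ps_rew \<R>) \<pi>"
  shows "E_confluent \<R>"
proof -
  interpret rewriting_modulo "E_step \<R>" "rew \<R>" "ps_rew \<R>"
  proof (unfold_locales, fold mod_rew_eq_E_steps)
    show "wfp (mod_rew \<R>)\<inverse>\<inverse>"
      using terminating unfolding E_terminating_def wfp_def wf_iff_no_infinite_down_chain by simp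
    show "join_modulo (E_step \<R>)\<^sup>*\<^sup>* (ps_rew \<R>) t t'" if "ps_rew \<R> s t" "rew \<R> s t'" for s t t'
      using ps_rew_rew_peak_joinable that pairs by (blast intro: join_modulo_mono E_eq_imp_E_steps)
    show "join_modulo (E_step \<R>)\<^sup>*\<^sup>* (ps_rew \<R>) t t'" if "ps_rew \<R> s t" "E_step \<R> s t'" for s t t'
      using ps_rew_E_step_peak_joinable that pairs
      by (blast intro: join_modulo_mono E_eq_imp_E_steps)
  qed (fact symp_E_step rew_ps_rew ps_rew_mod_rew)+
  show ?thesis
    unfolding E_confluent_def
  proof (intro allI impI, elim conjE)
    fix s t t'
    assume "wf_trm \<R> s" and steps: "(mod_rew \<R>)\<^sup>*\<^sup>* s t" "(mod_rew \<R>)\<^sup>*\<^sup>* s t'"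
    obtain u u' where join: "(ps_rew \<R>)\<^sup>*\<^sup>* t u" "(ps_rew \<R>)\<^sup>*\<^sup>* t' u'" "(E_step \<R>)\<^sup>*\<^sup>* u u'"
      using confluent_modulo steps unfolding mod_rew_eq_E_steps join_modulo_def by blast
    then have mods: "(mod_rew \<R>)\<^sup>*\<^sup>* t u" "(mod_rew \<R>)\<^sup>*\<^sup>* t' u'" using ps_rews_mod_rews by blast+
    moreover have "wf_trm \<R> u" using mod_rews_wf steps(1) mods(1) \<open>wf_trm \<R> s\<close> by blast
    ultimately show "\<exists>u u'. (mod_rew \<R>)\<^sup>*\<^sup>* t u \<and> (mod_rew \<R>)\<^sup>*\<^sup>* t' u' \<and> E_eq \<R> u u'"
      using join(3) E_eq_iff_E_steps by blast
  qed
qed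

end

theorem theorem11p1:
  fixes \<R> :: "('f, 'p, 'v :: {countable, infinite}) egtrs"
  assumes "is_egtrs \<R>"
  shows "(E_terminating \<R> \<and>
          (\<forall>\<pi> \<in> LCCP \<R> \<union> CVP_ps \<R> \<union> DCP \<R> \<union> LCCP_E \<R> \<union> CVP_ps_E \<R>.
             joinable_mod \<R> (ps_rew \<R>) \<pi>) \<longrightarrow> E_confluent \<R>) \<and>
         ((\<exists>\<pi> \<in> LCCP \<R> \<union> CVP_ps \<R> \<union> DCP \<R>. \<not> joinable_mod \<R> (mod_rew \<R>) \<pi>) \<longrightarrow>
            \<not> E_confluent \<R>)"
proof -
  interpret infinite_egtrs \<R> using assms by unfold_locales
  show ?thesis using pairs_joinable_imp_E_confluent E_confluent_imp_pairs_joinable by blast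
qed

end
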